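(* Let $\lambda$ be a regular cardinal, let $\mathcal K$ be a locally $\lambda$-presentable category and let $T$ be a $\lambda$-ary monad on $\mathcal K$. Then there is a $\lambda$-ary equational theory $E$ over $\mathcal K$ such that the categories $\mathcal K^T$ (Eilenberg–Moore algebras of $T$) and $\mathbf{Alg}(E)$ are equivalent as concrete categories over $\mathcal K$ (i.e. equivalent compatibly with the forgetful functors to $\mathcal K$).
   Context: A monad on a locally presentable category is $\lambda$-ary if its underlying endofunctor preserves $\lambda$-filtered colimits (equivalently, $\lambda$-directed colimits). For objects $X,A$ of $\mathcal K$ write $A^X$ for the set $\mathcal K(X,A)$; for $f:Y\to X$ write $A^f=\mathcal K(f,A):A^X\to A^Y$, and for $h:A\to B$ write $h^X=\mathcal K(X,h):A^X\to B^X$. Let $\mathcal A$ be a full subcategory of $\mathcal K$. An $\mathcal A$-ary type $t$ over $\mathcal K$ is a class $\Omega$ with a mapping $t:\Omega\to\mathrm{ob}(\mathcal A)\times\mathrm{ob}(\mathcal A)$ such that $\Omega^{X,Y}=t^{-1}(X,Y)$ is a set for all $X,Y$. Elements of $\Omega^{X,Y}$ are $(X,Y)$-ary operation symbols. Terms are defined inductively: every $\omega\in\Omega^{X,Y}$ is an $(X,Y)$-ary term; every morphism $f:Y\to X$ of $\mathcal A$ determines an $(X,Y)$-ary term $x_f$; if $p$ is an $(X,Y)$-ary term and $q$ a $(Y,Z)$-ary term then $qp$ is an $(X,Z)$-ary term; terms are identified according to $x_{fg}=x_gx_f$, $(pq)r=p(qr)$ and $x_{\mathrm{id}_Y}p=p=px_{\mathrm{id}_X}$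 for $p$ an $(X,Y)$-ary term. An equation $p=q$ is a pair of terms of the same arity $(X,Y)$, and an equational theory $E$ of type $t$ is a class of equations. An algebra of type $t$ is an object $A$ of $\mathcal K$ with mappings $\omega_A:A^X\to A^Y$ for all $\omega\in\Omega^{X,Y}$. Terms are interpreted by $(x_f)_A=A^f$ and $(qp)_A=q_Ap_A$. $A$ satisfies $p=q$ if $p_A=q_A$; an $E$-algebra is an algebra satisfying all equations of $E$. A homomorphism $A\to B$ is a morphism $h:A\to B$ of $\mathcal K$ with $h^Y\omega_A=\omega_Bh^X$ for every $\omega\in\Omega^{X,Y}$. This gives the category $\mathbf{Alg}(E)$ and the forgetful functor $U_E:\mathbf{Alg}(E)\to\mathcal K$. A type over a locally $\lambda$-presentable category $\mathcal K$ is $\lambda$-ary if it is $\mathcal K_\lambda$-ary, where $\mathcal K_\lambda$ is a (representative) small full subcategory of the $\lambda$-presentable objects of $\mathcal K$. An equational theory is $\lambda$-ary if its type is. *)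

theory Defs
  imports Main "HOL-Library.FuncSet"
begin

unbundle cardinal_syntax

section \<open>Categories, functors, natural isomorphisms\<close>

text \<open>Objects and arrows may form arbitrary subsets of the types \<open>'o\<close> and \<open>'m\<close>; outside of
  these subsets the operations are unspecified.  Composition is written in the usual order,
  so \<open>g \<cdot> f\<close> is ``first \<open>f\<close>, then \<open>g\<close>''.\<close>

record ('o, 'm) cat =
  Obj :: "'o set"
  Arr :: "'m set"
  Dom :: "'m \<Rightarrow> 'o"
  Cod :: "'m \<Rightarrow> 'o"
  Ide :: "'o \<Rightarrow> 'm"
  Comp :: "'m \<Rightarrow> 'm \<Rightarrow> 'm"  (infixl "\<cdot>\<index>" 70)

definition hom :: "('o, 'm) cat \<Rightarrow> 'o \<Rightarrow> 'o \<Rightarrow> 'm set" where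
  "hom C X Y = {f \<in> Arr C. Dom C f = X \<and> Cod C f = Y}"

locale category =
  fixes C :: "('o, 'm) cat" (structure)
  assumes Dom_in: "f \<in> Arr C \<Longrightarrow> Dom C f \<in> Obj C"
    and Cod_in: "f \<in> Arr C \<Longrightarrow> Cod C f \<in> Obj C"
    and Ide_in: "X \<in> Obj C \<Longrightarrow> Ide C X \<in> hom C X X"
    and Comp_in: "f \<in> hom C X Y \<Longrightarrow> g \<in> hom C Y Z \<Longrightarrow> g \<cdot> f \<in> hom C X Z"
    and Ide_left: "f \<in> hom C X Y \<Longrightarrow> Ide C Y \<cdot> f = f"
    and Ide_right: "f \<in> hom C X Y \<Longrightarrow> f \<cdot> Ide C X = f"
    and Comp_assoc: "f \<in> hom C W X \<Longrightarrow> g \<in> hom C X Y \<Longrightarrow> h \<in> hom C Y Z \<Longrightarrow>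
      (h \<cdot> g) \<cdot> f = h \<cdot> (g \<cdot> f)"

definition iso_arr :: "('o, 'm) cat \<Rightarrow> 'o \<Rightarrow> 'o \<Rightarrow> 'm \<Rightarrow> bool" where
  "iso_arr C X Y f \<longleftrightarrow> f \<in> hom C X Y \<and>
    (\<exists>g\<in>hom C Y X. g \<cdot>\<^bsub>C\<^esub> f = Ide C X \<and> f \<cdot>\<^bsub>C\<^esub> g = Ide C Y)"

definition isomorphic :: "('o, 'm) cat \<Rightarrow> 'o \<Rightarrow> 'o \<Rightarrow> bool" where
  "isomorphic C X Y \<longleftrightarrow> (\<exists>f. iso_arr C X Y f)"

record ('o, 'm, 'p, 'n) ftor =
  onObj :: "'o \<Rightarrow> 'p"
  onArr :: "'m \<Rightarrow> 'n"

definition is_functor :: "('o, 'm) cat \<Rightarrow> ('p, 'n) cat \<Rightarrow> ('o, 'm, 'p, 'n) ftor \<Rightarrow> bool" where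
  "is_functor C D F \<longleftrightarrow>
    (\<forall>X\<in>Obj C. onObj F X \<in> Obj D) \<and>
    (\<forall>f\<in>Arr C. onArr F f \<in> hom D (onObj F (Dom C f)) (onObj F (Cod C f))) \<and>
    (\<forall>X\<in>Obj C. onArr F (Ide C X) = Ide D (onObj F X)) \<and>
    (\<forall>f\<in>Arr C. \<forall>g\<in>Arr C. Dom C g = Cod C f \<longrightarrow>
      onArr F (g \<cdot>\<^bsub>C\<^esub> f) = onArr F g \<cdot>\<^bsub>D\<^esub> onArr F f)"

definition ftor_id :: "('o, 'm, 'o, 'm) ftor" where
  "ftor_id = \<lparr>onObj = (\<lambda>X. X), onArr = (\<lambda>f. f)\<rparr>"

definition ftor_comp ::
  "('p, 'n, 'q, 'k) ftor \<Rightarrow> ('o, 'm, 'p, 'n) ftor \<Rightarrow> ('o, 'm, 'q, 'k) ftor" (infixl "\<circ>\<^sub>F" 70) where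
  "G \<circ>\<^sub>F F = \<lparr>onObj = onObj G \<circ> onObj F, onArr = onArr G \<circ> onArr F\<rparr>"

definition ftor_eq_on ::
  "('o, 'm) cat \<Rightarrow> ('o, 'm, 'p, 'n) ftor \<Rightarrow> ('o, 'm, 'p, 'n) ftor \<Rightarrow> bool" where
  "ftor_eq_on C F G \<longleftrightarrow>
    (\<forall>X\<in>Obj C. onObj F X = onObj G X) \<and> (\<forall>f\<in>Arr C. onArr F f = onArr G f)"

definition is_nat_trans :: "('o, 'm) cat \<Rightarrow> ('p, 'n) cat \<Rightarrow>
    ('o, 'm, 'p, 'n) ftor \<Rightarrow> ('o, 'm, 'p, 'n) ftor \<Rightarrow> ('o \<Rightarrow> 'n) \<Rightarrow> bool" where
  "is_nat_trans C D F G \<tau> \<longleftrightarrow>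
    (\<forall>X\<in>Obj C. \<tau> X \<in> hom D (onObj F X) (onObj G X)) \<and>
    (\<forall>f\<in>Arr C. \<tau> (Cod C f) \<cdot>\<^bsub>D\<^esub> onArr F f = onArr G f \<cdot>\<^bsub>D\<^esub> \<tau> (Dom C f))"

definition nat_isomorphic :: "('o, 'm) cat \<Rightarrow> ('p, 'n) cat \<Rightarrow>
    ('o, 'm, 'p, 'n) ftor \<Rightarrow> ('o, 'm, 'p, 'n) ftor \<Rightarrow> bool" where
  "nat_isomorphic C D F G \<longleftrightarrow>
    (\<exists>\<tau>. is_nat_trans C D F G \<tau> \<and> (\<forall>X\<in>Obj C. iso_arr D (onObj F X) (onObj G X) (\<tau> X)))"

text \<open>Equivalence of concrete categories \<open>(C, V)\<close> and \<open>(D, W)\<close> over a common base category: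
  an equivalence of categories both of whose functors commute with the forgetful functors.\<close>

definition concretely_equivalent :: "('o, 'm) cat \<Rightarrow> ('o, 'm, 'b, 'c) ftor \<Rightarrow>
    ('p, 'n) cat \<Rightarrow> ('p, 'n, 'b, 'c) ftor \<Rightarrow> bool" where
  "concretely_equivalent C V D W \<longleftrightarrow>
    (\<exists>\<Phi> \<Psi>. is_functor C D \<Phi> \<and> is_functor D C \<Psi> \<and>
      ftor_eq_on C (W \<circ>\<^sub>F \<Phi>) V \<and> ftor_eq_on D (V \<circ>\<^sub>F \<Psi>) W \<and>
      nat_isomorphic C C (\<Psi> \<circ>\<^sub>F \<Phi>) ftor_id \<and> nat_isomorphic D D (\<Phi> \<circ>\<^sub>F \<Psi>) ftor_id)"


section \<open>Colimits\<close>

definition is_cocone :: "('i, 'j) cat \<Rightarrow> ('o, 'm) cat \<Rightarrow> ('i, 'j, 'o, 'm) ftor \<Rightarrow>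
    'o \<Rightarrow> ('i \<Rightarrow> 'm) \<Rightarrow> bool" where
  "is_cocone J C F c \<tau> \<longleftrightarrow> c \<in> Obj C \<and>
    (\<forall>j\<in>Obj J. \<tau> j \<in> hom C (onObj F j) c) \<and>
    (\<forall>u\<in>Arr J. \<tau> (Cod J u) \<cdot>\<^bsub>C\<^esub> onArr F u = \<tau> (Dom J u))"

definition is_colimit :: "('i, 'j) cat \<Rightarrow> ('o, 'm) cat \<Rightarrow> ('i, 'j, 'o, 'm) ftor \<Rightarrow>
    'o \<Rightarrow> ('i \<Rightarrow> 'm) \<Rightarrow> bool" where
  "is_colimit J C F c \<tau> \<longleftrightarrow> is_cocone J C F c \<tau> \<and>
    (\<forall>d \<sigma>. is_cocone J C F d \<sigma> \<longrightarrow>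
      (\<exists>!h. h \<in> hom C c d \<and> (\<forall>j\<in>Obj J. h \<cdot>\<^bsub>C\<^esub> \<tau> j = \<sigma> j)))"


section \<open>Size, filteredness and local presentability\<close>

text \<open>``Set'' as opposed to ``class'' is read relative to an infinite regular cardinal \<open>U\<close>, the
  size of the universe: a collection is a (small) set iff it has fewer than \<open>U\<close> elements.
  For a Grothendieck universe \<open>U\<close> is inaccessible, but only regularity is ever assumed of it.
  Up to isomorphism every small category has its objects and arrows in the type \<open>'u\<close> that
  carries \<open>U\<close>, so small diagrams are indexed by categories of type \<open>('u, 'u) cat\<close>.
  Likewise a category with fewer than \<open>lam\<close> arrows may be taken to live in the type carrying
  \<open>lam\<close>.\<close>

definition regular_cardinal :: "'a rel \<Rightarrow> bool" where
  "regular_cardinal r \<longleftrightarrow> Cinfinite r \<and> regularCard r"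

definition small :: "'u rel \<Rightarrow> 'a set \<Rightarrow> bool" where
  "small U A \<longleftrightarrow> |A| <o U"

definition small_category :: "'u rel \<Rightarrow> ('o, 'm) cat \<Rightarrow> bool" where
  "small_category U J \<longleftrightarrow> category J \<and> small U (Obj J) \<and> small U (Arr J)"

definition locally_small :: "'u rel \<Rightarrow> ('o, 'm) cat \<Rightarrow> bool" where
  "locally_small U C \<longleftrightarrow> (\<forall>X\<in>Obj C. \<forall>Y\<in>Obj C. small U (hom C X Y))"

definition cocomplete :: "'u rel \<Rightarrow> ('o, 'm) cat \<Rightarrow> bool" where
  "cocomplete U C \<longleftrightarrow>
    (\<forall>(J :: ('u, 'u) cat) F. small_category U J \<and> is_functor J C F \<longrightarrow>
      (\<exists>c \<tau>. is_colimit J C F c \<tau>))"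

definition filtered :: "'l rel \<Rightarrow> ('i, 'j) cat \<Rightarrow> bool" where
  "filtered lam J \<longleftrightarrow>
    (\<forall>(I :: ('l, 'l) cat) D. category I \<and> |Arr I| <o lam \<and> is_functor I J D \<longrightarrow>
      (\<exists>c \<tau>. is_cocone I J D c \<tau>))"

definition preserves_filtered_colimits :: "'u rel \<Rightarrow> 'l rel \<Rightarrow> ('o, 'm) cat \<Rightarrow> ('p, 'n) cat \<Rightarrow>
    ('o, 'm, 'p, 'n) ftor \<Rightarrow> bool" where
  "preserves_filtered_colimits U lam C D G \<longleftrightarrow>
    (\<forall>(J :: ('u, 'u) cat) F c \<tau>. small_category U J \<and> filtered lam J \<and> is_functor J C F \<and>
      is_colimit J C F c \<tau> \<longrightarrow>
      is_colimit J D (G \<circ>\<^sub>F F) (onObj G c) (\<lambda>j. onArr G (\<tau> j)))"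

text \<open>The category of small sets with elements in \<open>'a\<close>; an arrow is a map together with its
  domain and codomain.  Below, \<open>'a\<close> is the type of arrows of the category under consideration,
  so that all hom-sets are objects.  The restriction to subsets of \<open>'a\<close> does not affect which
  cocones of hom-sets over a filtered diagram are colimits: this is decided by cocones into
  sets with at most two elements.\<close>

definition set_cat :: "'u rel \<Rightarrow> ('a set, 'a set \<times> ('a \<Rightarrow> 'a) \<times> 'a set) cat" where
  "set_cat U = \<lparr>
    Obj = {A. small U A},
    Arr = {(A, f, B). small U A \<and> small U B \<and> f \<in> A \<rightarrow>\<^sub>E B},
    Dom = (\<lambda>(A, f, B). A),
    Cod = (\<lambda>(A, f, B). B),
    Ide = (\<lambda>A. (A, restrict (\<lambda>x. x) A, A)),
    Comp = (\<lambda>(B', g, C) (A, f, B). (A, compose A g f, C))\<rparr>"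

definition hom_ftor :: "('o, 'm) cat \<Rightarrow> 'o \<Rightarrow>
    ('o, 'm, 'm set, 'm set \<times> ('m \<Rightarrow> 'm) \<times> 'm set) ftor" where
  "hom_ftor C X = \<lparr>
    onObj = hom C X,
    onArr = (\<lambda>h. (hom C X (Dom C h), \<lambda>f\<in>hom C X (Dom C h). h \<cdot>\<^bsub>C\<^esub> f, hom C X (Cod C h)))\<rparr>"

definition presentable :: "'u rel \<Rightarrow> 'l rel \<Rightarrow> ('o, 'm) cat \<Rightarrow> 'o \<Rightarrow> bool" where
  "presentable U lam C X \<longleftrightarrow> X \<in> Obj C \<and>
    preserves_filtered_colimits U lam C (set_cat U) (hom_ftor C X)"

definition locally_presentable :: "'u rel \<Rightarrow> 'l rel \<Rightarrow> ('o, 'm) cat \<Rightarrow> bool" where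
  "locally_presentable U lam C \<longleftrightarrow>
    category C \<and> locally_small U C \<and> cocomplete U C \<and>
    (\<exists>G. small U G \<and> (\<forall>X\<in>G. presentable U lam C X) \<and>
      (\<forall>A\<in>Obj C. \<exists>(J :: ('u, 'u) cat) F \<tau>. small_category U J \<and> filtered lam J \<and>
        is_functor J C F \<and> (\<forall>j\<in>Obj J. onObj F j \<in> G) \<and> is_colimit J C F A \<tau>))"

text \<open>\<open>P\<close> is (the set of objects of) a representative small full subcategory of the
  \<open>lam\<close>-presentable objects.  Full subcategories are given by their sets of objects.\<close>

definition representative_presentables ::
  "'u rel \<Rightarrow> 'l rel \<Rightarrow> ('o, 'm) cat \<Rightarrow> 'o set \<Rightarrow> bool" where
  "representative_presentables U lam C P \<longleftrightarrow>
    small U P \<and> (\<forall>X\<in>P. presentable U lam C X) \<and>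
    (\<forall>X. presentable U lam C X \<longrightarrow> (\<exists>Y\<in>P. isomorphic C X Y))"


section \<open>Monads and Eilenberg-Moore algebras\<close>

record ('o, 'm) monad =
  endo :: "('o, 'm, 'o, 'm) ftor"
  unt :: "'o \<Rightarrow> 'm"
  mlt :: "'o \<Rightarrow> 'm"

definition is_monad :: "('o, 'm) cat \<Rightarrow> ('o, 'm) monad \<Rightarrow> bool" where
  "is_monad C T \<longleftrightarrow>
    is_functor C C (endo T) \<and>
    is_nat_trans C C ftor_id (endo T) (unt T) \<and>
    is_nat_trans C C (endo T \<circ>\<^sub>F endo T) (endo T) (mlt T) \<and>
    (\<forall>X\<in>Obj C. mlt T X \<cdot>\<^bsub>C\<^esub> unt T (onObj (endo T) X) = Ide C (onObj (endo T) X)) \<and>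
    (\<forall>X\<in>Obj C. mlt T X \<cdot>\<^bsub>C\<^esub> onArr (endo T) (unt T X) = Ide C (onObj (endo T) X)) \<and>
    (\<forall>X\<in>Obj C. mlt T X \<cdot>\<^bsub>C\<^esub> mlt T (onObj (endo T) X) = mlt T X \<cdot>\<^bsub>C\<^esub> onArr (endo T) (mlt T X))"

definition ary_monad :: "'u rel \<Rightarrow> 'l rel \<Rightarrow> ('o, 'm) cat \<Rightarrow> ('o, 'm) monad \<Rightarrow> bool" where
  "ary_monad U lam C T \<longleftrightarrow> is_monad C T \<and> preserves_filtered_colimits U lam C C (endo T)"

text \<open>A concrete category over \<open>C\<close> whose objects are objects \<open>A\<close> of \<open>C\<close> with some structure \<open>a\<close>,
  given by its objects and by the arrows of \<open>C\<close> that are homomorphisms between two of them.\<close>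

definition concrete_cat :: "('o, 'm) cat \<Rightarrow> ('o \<times> 's) set \<Rightarrow>
    ('o \<times> 's \<Rightarrow> 'o \<times> 's \<Rightarrow> 'm \<Rightarrow> bool) \<Rightarrow>
    ('o \<times> 's, ('o \<times> 's) \<times> 'm \<times> ('o \<times> 's)) cat" where
  "concrete_cat C S is_hom = \<lparr>
    Obj = S,
    Arr = {(a, h, b). a \<in> S \<and> b \<in> S \<and> h \<in> hom C (fst a) (fst b) \<and> is_hom a b h},
    Dom = (\<lambda>(a, h, b). a),
    Cod = (\<lambda>(a, h, b). b),
    Ide = (\<lambda>a. (a, Ide C (fst a), a)),
    Comp = (\<lambda>(b', k, c) (a, h, b). (a, k \<cdot>\<^bsub>C\<^esub> h, c))\<rparr>"

definition forget :: "('o \<times> 's, ('o \<times> 's) \<times> 'm \<times> ('o \<times> 's), 'o, 'm) ftor" where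
  "forget = \<lparr>onObj = fst, onArr = (\<lambda>(a, h, b). h)\<rparr>"

definition EM :: "('o, 'm) cat \<Rightarrow> ('o, 'm) monad \<Rightarrow>
    ('o \<times> 'm, ('o \<times> 'm) \<times> 'm \<times> ('o \<times> 'm)) cat" where
  "EM C T = concrete_cat C
    {(A, a). A \<in> Obj C \<and> a \<in> hom C (onObj (endo T) A) A \<and>
      a \<cdot>\<^bsub>C\<^esub> unt T A = Ide C A \<and> a \<cdot>\<^bsub>C\<^esub> mlt T A = a \<cdot>\<^bsub>C\<^esub> onArr (endo T) a}
    (\<lambda>(A, a) (B, b) h. h \<cdot>\<^bsub>C\<^esub> a = b \<cdot>\<^bsub>C\<^esub> onArr (endo T) h)"


section \<open>Types, terms, equational theories and their algebras\<close>

text \<open>The set \<open>S\<close> always denotes the set of objects of the full subcategory providing the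
  arities.\<close>

record ('o, 'w) optype =
  Ops :: "'w set"
  arity :: "'w \<Rightarrow> 'o \<times> 'o"

definition ops_of :: "('o, 'w) optype \<Rightarrow> 'o \<Rightarrow> 'o \<Rightarrow> 'w set" where
  "ops_of t X Y = {\<omega> \<in> Ops t. arity t \<omega> = (X, Y)}"

definition is_type :: "'u rel \<Rightarrow> ('o, 'm) cat \<Rightarrow> 'o set \<Rightarrow> ('o, 'w) optype \<Rightarrow> bool" where
  "is_type U C S t \<longleftrightarrow> S \<subseteq> Obj C \<and> arity t \<in> Ops t \<rightarrow> S \<times> S \<and>
    (\<forall>X\<in>S. \<forall>Y\<in>S. small U (ops_of t X Y))"

text \<open>Terms are equivalence classes of the following preterms, where \<open>Var f\<close> is the term \<open>x\<^sub>f\<close>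
  and \<open>Seq q p\<close> is the composite \<open>qp\<close>.\<close>

datatype ('w, 'm) preterm =
  Op 'w
| Var 'm
| Seq "('w, 'm) preterm" "('w, 'm) preterm"

inductive has_arity :: "('o, 'm) cat \<Rightarrow> 'o set \<Rightarrow> ('o, 'w) optype \<Rightarrow>
    ('w, 'm) preterm \<Rightarrow> 'o \<Rightarrow> 'o \<Rightarrow> bool"
  for C S t where
  has_arity_Op: "\<omega> \<in> ops_of t X Y \<Longrightarrow> has_arity C S t (Op \<omega>) X Y"
| has_arity_Var: "X \<in> S \<Longrightarrow> Y \<in> S \<Longrightarrow> f \<in> hom C Y X \<Longrightarrow> has_arity C S t (Var f) X Y"
| has_arity_Seq: "has_arity C S t p X Y \<Longrightarrow> has_arity C S t q Y Z \<Longrightarrow>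
    has_arity C S t (Seq q p) X Z"

inductive identified :: "('o, 'm) cat \<Rightarrow> 'o set \<Rightarrow> ('o, 'w) optype \<Rightarrow>
    'o \<Rightarrow> 'o \<Rightarrow> ('w, 'm) preterm \<Rightarrow> ('w, 'm) preterm \<Rightarrow> bool"
  for C S t where
  identified_refl: "has_arity C S t p X Y \<Longrightarrow> identified C S t X Y p p"
| identified_sym: "identified C S t X Y p q \<Longrightarrow> identified C S t X Y q p"
| identified_trans: "identified C S t X Y p q \<Longrightarrow> identified C S t X Y q r \<Longrightarrow>
    identified C S t X Y p r"
| identified_cong: "identified C S t X Y p p' \<Longrightarrow> identified C S t Y Z q q' \<Longrightarrow>
    identified C S t X Z (Seq q p) (Seq q' p')"
| identified_Var_Comp: "X \<in> S \<Longrightarrow> Y \<in> S \<Longrightarrow> Z \<in> S \<Longrightarrow> f \<in> hom C Y X \<Longrightarrow> g \<in> hom C Z Y \<Longrightarrow>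
    identified C S t X Z (Var (f \<cdot>\<^bsub>C\<^esub> g)) (Seq (Var g) (Var f))"
| identified_assoc: "has_arity C S t r W X \<Longrightarrow> has_arity C S t q X Y \<Longrightarrow> has_arity C S t p Y Z \<Longrightarrow>
    identified C S t W Z (Seq (Seq p q) r) (Seq p (Seq q r))"
| identified_Ide_left: "has_arity C S t p X Y \<Longrightarrow>
    identified C S t X Y (Seq (Var (Ide C Y)) p) p"
| identified_Ide_right: "has_arity C S t p X Y \<Longrightarrow>
    identified C S t X Y (Seq p (Var (Ide C X))) p"

definition terms :: "('o, 'm) cat \<Rightarrow> 'o set \<Rightarrow> ('o, 'w) optype \<Rightarrow> 'o \<Rightarrow> 'o \<Rightarrow>
    ('w, 'm) preterm set set" where
  "terms C S t X Y = {p. has_arity C S t p X Y} // {(p, q). identified C S t X Y p q}"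

definition is_equational_theory :: "('o, 'm) cat \<Rightarrow> 'o set \<Rightarrow> ('o, 'w) optype \<Rightarrow>
    (('w, 'm) preterm set \<times> ('w, 'm) preterm set) set \<Rightarrow> bool" where
  "is_equational_theory C S t E \<longleftrightarrow> E \<subseteq> (\<Union>X\<in>S. \<Union>Y\<in>S. terms C S t X Y \<times> terms C S t X Y)"

text \<open>An algebra of type \<open>t\<close> is a pair \<open>(A, \<phi>)\<close> where \<open>\<phi> \<omega>\<close> is the operation \<open>\<omega>\<^sub>A\<close>.  Extensionality
  makes two algebras equal iff they have the same underlying object and the same operations.\<close>

definition algebras :: "('o, 'm) cat \<Rightarrow> ('o, 'w) optype \<Rightarrow> ('o \<times> ('w \<Rightarrow> 'm \<Rightarrow> 'm)) set" where
  "algebras C t = {(A, \<phi>). A \<in> Obj C \<and>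
    \<phi> \<in> (\<Pi>\<^sub>E \<omega>\<in>Ops t. hom C (fst (arity t \<omega>)) A \<rightarrow>\<^sub>E hom C (snd (arity t \<omega>)) A)}"

fun interp :: "('o, 'm) cat \<Rightarrow> ('w \<Rightarrow> 'm \<Rightarrow> 'm) \<Rightarrow> ('w, 'm) preterm \<Rightarrow> 'm \<Rightarrow> 'm" where
  "interp C \<phi> (Op \<omega>) a = \<phi> \<omega> a"
| "interp C \<phi> (Var f) a = a \<cdot>\<^bsub>C\<^esub> f"
| "interp C \<phi> (Seq q p) a = interp C \<phi> q (interp C \<phi> p a)"

text \<open>Identified preterms have the same interpretation, so it is immaterial which
  representatives \<open>p\<close> and \<open>q\<close> of the terms \<open>P\<close> and \<open>Q\<close> are used.\<close>

definition satisfies :: "('o, 'm) cat \<Rightarrow> 'o set \<Rightarrow> ('o, 'w) optype \<Rightarrow>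
    'o \<times> ('w \<Rightarrow> 'm \<Rightarrow> 'm) \<Rightarrow> ('w, 'm) preterm set \<times> ('w, 'm) preterm set \<Rightarrow> bool" where
  "satisfies C S t = (\<lambda>(A, \<phi>) (P, Q). \<forall>X\<in>S. \<forall>Y\<in>S.
    P \<in> terms C S t X Y \<and> Q \<in> terms C S t X Y \<longrightarrow>
    (\<forall>p\<in>P. \<forall>q\<in>Q. \<forall>a\<in>hom C X A. interp C \<phi> p a = interp C \<phi> q a))"

definition Alg :: "('o, 'm) cat \<Rightarrow> 'o set \<Rightarrow> ('o, 'w) optype \<Rightarrow>
    (('w, 'm) preterm set \<times> ('w, 'm) preterm set) set \<Rightarrow>
    ('o \<times> ('w \<Rightarrow> 'm \<Rightarrow> 'm),
     ('o \<times> ('w \<Rightarrow> 'm \<Rightarrow> 'm)) \<times> 'm \<times> ('o \<times> ('w \<Rightarrow> 'm \<Rightarrow> 'm))) cat" where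
  "Alg C S t E = concrete_cat C
    {\<A> \<in> algebras C t. \<forall>e\<in>E. satisfies C S t \<A> e}
    (\<lambda>(A, \<phi>) (B, \<psi>) h. \<forall>\<omega>\<in>Ops t. \<forall>a\<in>hom C (fst (arity t \<omega>)) A.
      h \<cdot>\<^bsub>C\<^esub> \<phi> \<omega> a = \<psi> \<omega> (h \<cdot>\<^bsub>C\<^esub> a))"

end

theory Submission
  imports Defs
begin

text \<open>
  The operations of arity \<open>(X, Y)\<close> are the arrows \<open>w : Y \<rightarrow> T X\<close>, and the equations are all those valid
  in every Eilenberg--Moore algebra.  Since \<open>A\<close> is a filtered colimit of objects of \<open>Kl\<close>, through
  which maps from \<open>Kl\<close> into \<open>A\<close> factor, for each \<open>H\<close> among the identity, \<open>T\<close> and \<open>T T\<close> an arrow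
  \<open>H A \<rightarrow> B\<close> amounts to a compatible family of arrows \<open>H X \<rightarrow> B\<close> indexed by all \<open>f : X \<rightarrow> A\<close> with \<open>X\<close>
  in \<open>Kl\<close>.  Given an algebra \<open>(A, \<phi>)\<close> of the theory, the equations between \<open>w \<cdot> g\<close> and \<open>x\<^sub>g w\<close> glue
  the elements \<open>\<phi>\<^sub>w f\<close> to an arrow \<open>T X \<rightarrow> A\<close> for every \<open>f : X \<rightarrow> A\<close>; the equations between
  \<open>T g \<cdot> w\<close> and \<open>w x\<^sub>g\<close> glue these arrows to a structure map \<open>a : T A \<rightarrow> A\<close>; the equations
  identifying \<open>\<eta>\<^sub>X\<close> with \<open>x\<^sub>i\<^sub>d\<close>, and \<open>\<mu>\<^sub>X \<cdot> T w \<cdot> v\<close> with \<open>v w\<close>, give the unit and associativity laws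
  for \<open>a\<close>.  This makes the comparison bijective on objects and on homomorphisms.
\<close>

section \<open>Functors preserving filtered colimits\<close>

lemma homI: "f \<in> Arr C \<Longrightarrow> Dom C f = X \<Longrightarrow> Cod C f = Y \<Longrightarrow> f \<in> hom C X Y"
  by (simp add: hom_def)

lemma homD:
  assumes "f \<in> hom C X Y"
  shows "f \<in> Arr C" "Dom C f = X" "Cod C f = Y"
  using assms by (simp_all add: hom_def)

lemma (in category) hom_Obj:
  assumes "f \<in> hom C X Y"
  shows "X \<in> Obj C" "Y \<in> Obj C"
  using assms Dom_in Cod_in by (auto simp: hom_def)

lemma functor_Obj: "is_functor C D F \<Longrightarrow> X \<in> Obj C \<Longrightarrow> onObj F X \<in> Obj D"
  by (simp add: is_functor_def)

lemma functor_hom: "is_functor C D F \<Longrightarrow> f \<in> hom C X Y \<Longrightarrow> onArr F f \<in> hom D (onObj F X) (onObj F Y)"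
  unfolding is_functor_def hom_def by auto

lemma functor_Ide: "is_functor C D F \<Longrightarrow> X \<in> Obj C \<Longrightarrow> onArr F (Ide C X) = Ide D (onObj F X)"
  by (simp add: is_functor_def)

lemma functor_Comp:
  "is_functor C D F \<Longrightarrow> f \<in> hom C X Y \<Longrightarrow> g \<in> hom C Y Z \<Longrightarrow>
    onArr F (g \<cdot>\<^bsub>C\<^esub> f) = onArr F g \<cdot>\<^bsub>D\<^esub> onArr F f"
  unfolding is_functor_def hom_def by auto

lemma (in category) is_functor_comp:
  assumes F: "is_functor C D F" and G: "is_functor D E G"
  shows "is_functor C E (G \<circ>\<^sub>F F)"
proof -
  have "onArr G (onArr F (g \<cdot> f)) = onArr G (onArr F g) \<cdot>\<^bsub>E\<^esub> onArr G (onArr F f)"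
    if "f \<in> Arr C" "g \<in> Arr C" "Dom C g = Cod C f" for f g
  proof -
    have f: "f \<in> hom C (Dom C f) (Cod C f)" and g: "g \<in> hom C (Cod C f) (Cod C g)"
      using that by (simp_all add: hom_def)
    show ?thesis
      using functor_Comp[OF F f g] functor_Comp[OF G functor_hom[OF F f] functor_hom[OF F g]] by simp
  qed
  moreover have "onArr G (onArr F f) \<in> hom E (onObj G (onObj F (Dom C f))) (onObj G (onObj F (Cod C f)))"
    if "f \<in> Arr C" for f
    by (intro functor_hom[OF G] functor_hom[OF F] homI that refl)
  ultimately show ?thesis
    unfolding is_functor_def[of C E] using F G
    by (simp add: ftor_comp_def functor_Obj functor_Ide)
qed

lemma (in category) is_functor_id: "is_functor C C ftor_id"
  unfolding is_functor_def ftor_id_def by (auto simp: Dom_in Cod_in intro: homI)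

lemma ftor_id_simps [simp]: "onObj ftor_id X = X" "onArr ftor_id f = f"
  by (simp_all add: ftor_id_def)

lemma ftor_comp_simps [simp]:
  "onObj (G \<circ>\<^sub>F F) X = onObj G (onObj F X)" "onArr (G \<circ>\<^sub>F F) f = onArr G (onArr F f)"
  by (simp_all add: ftor_comp_def)

lemma ftor_comp_id: "ftor_id \<circ>\<^sub>F F = F"
  by (simp add: ftor_comp_def ftor_id_def comp_def)

lemma ftor_comp_assoc: "(H \<circ>\<^sub>F G) \<circ>\<^sub>F F = H \<circ>\<^sub>F (G \<circ>\<^sub>F F)"
  by (simp add: ftor_comp_def comp_assoc)

lemma preserves_filtered_colimits_id: "preserves_filtered_colimits U lam C C ftor_id"
  by (simp add: preserves_filtered_colimits_def ftor_comp_id)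

text \<open>Applied to the square of the monad functor, which is the domain of the arrows compared
  in the associativity law.\<close>

lemma preserves_filtered_colimits_comp:
  fixes U :: "'u rel"
  assumes "preserves_filtered_colimits U lam C D F" "preserves_filtered_colimits U lam D E G"
    and F: "is_functor C D F"
  shows "preserves_filtered_colimits U lam C E (G \<circ>\<^sub>F F)"
  unfolding preserves_filtered_colimits_def
proof (intro allI impI)
  fix J :: "('u, 'u) cat" and P c \<tau>
  assume a: "small_category U J \<and> filtered lam J \<and> is_functor J C P \<and> is_colimit J C P c \<tau>"
  then have "category J" by (simp add: small_category_def)
  then have "is_functor J D (F \<circ>\<^sub>F P)" using category.is_functor_comp a F by blast
  moreover have "is_colimit J D (F \<circ>\<^sub>F P) (onObj F c) (\<lambda>j. onArr F (\<tau> j))"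
    using assms(1) a unfolding preserves_filtered_colimits_def by blast
  ultimately have "is_colimit J E (G \<circ>\<^sub>F (F \<circ>\<^sub>F P)) (onObj G (onObj F c)) (\<lambda>j. onArr G (onArr F (\<tau> j)))"
    using assms(2) a unfolding preserves_filtered_colimits_def by blast
  then show "is_colimit J E (G \<circ>\<^sub>F F \<circ>\<^sub>F P) (onObj (G \<circ>\<^sub>F F) c) (\<lambda>j. onArr (G \<circ>\<^sub>F F) (\<tau> j))"
    by (simp add: ftor_comp_assoc)
qed

section \<open>Presentable objects are dense\<close>

lemma hom_set_cat:
  "hom (set_cat U) A B = {(A, f, B) | f. small U A \<and> small U B \<and> f \<in> A \<rightarrow>\<^sub>E B}"
  by (auto simp: hom_def set_cat_def)

lemma Comp_set_cat: "(B', g, D) \<cdot>\<^bsub>set_cat U\<^esub> (A, f, B) = (A, compose A g f, D)"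
  by (simp add: set_cat_def)

lemma small_subset: "small U B \<Longrightarrow> A \<subseteq> B \<Longrightarrow> small U A"
  unfolding small_def using card_of_mono1 ordLeq_ordLess_trans by blast

text \<open>The maps into the colimit that factor form a subset \<open>I\<close> of the hom-set; the colimit cocone of
  hom-sets corestricts to \<open>I\<close>, and the map induced by the corestriction must be the identity.\<close>

lemma (in category) presentable_factor:
  fixes U :: "'u rel" and J :: "('u, 'u) cat"
  assumes ls: "locally_small U C" and pres: "presentable U lam C X"
    and J: "small_category U J" "filtered lam J" and F: "is_functor J C F"
    and colim: "is_colimit J C F c \<tau>" and f: "f \<in> hom C X c"
  shows "\<exists>j\<in>Obj J. \<exists>g\<in>hom C X (onObj F j). f = \<tau> j \<cdot> g"
proof -
  interpret J: category J using J by (simp add: small_category_def)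
  have co: "is_cocone J C F c \<tau>" using colim by (simp add: is_colimit_def)
  have \<tau>: "\<tau> j \<in> hom C (onObj F j) c" if "j \<in> Obj J" for j
    using co that by (simp add: is_cocone_def)
  have X: "X \<in> Obj C" using pres by (simp add: presentable_def)
  have sm: "small U (hom C X Y)" if "Y \<in> Obj C" for Y
    using ls X that by (simp add: locally_small_def)
  let ?S = "set_cat U" and ?F = "hom_ftor C X \<circ>\<^sub>F F" and ?\<tau> = "\<lambda>j. onArr (hom_ftor C X) (\<tau> j)"
  have "is_colimit J ?S ?F (onObj (hom_ftor C X) c) ?\<tau>"
    using pres J F colim unfolding presentable_def preserves_filtered_colimits_def by blast
  then have colimS: "is_colimit J ?S ?F (hom C X c) ?\<tau>"
    by (simp add: hom_ftor_def)
  have \<tau>S: "?\<tau> j = (hom C X (onObj F j), \<lambda>g\<in>hom C X (onObj F j). \<tau> j \<cdot> g, hom C X c)"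
    if "j \<in> Obj J" for j
    using homD[OF \<tau>[OF that]] by (simp add: hom_ftor_def)
  define I where "I = {\<tau> j \<cdot> g | j g. j \<in> Obj J \<and> g \<in> hom C X (onObj F j)}"
  have Isub: "I \<subseteq> hom C X c"
    unfolding I_def using \<tau> Comp_in by blast
  have smc: "small U (hom C X c)" using sm hom_Obj(2)[OF f] .
  have smI: "small U I" using small_subset smc Isub .
  define \<sigma> where "\<sigma> j = (hom C X (onObj F j), \<lambda>g\<in>hom C X (onObj F j). \<tau> j \<cdot> g, I)" for j
  have "is_cocone J ?S ?F I \<sigma>"
    unfolding is_cocone_def
  proof (intro conjI ballI)
    show "I \<in> Obj ?S" using smI by (simp add: set_cat_def)
    show "\<sigma> j \<in> hom ?S (onObj ?F j) I" if "j \<in> Obj J" for j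
      using that smI sm[OF functor_Obj[OF F that]]
      by (auto simp: hom_set_cat \<sigma>_def hom_ftor_def I_def)
    show "\<sigma> (Cod J u) \<cdot>\<^bsub>?S\<^esub> onArr ?F u = \<sigma> (Dom J u)" if u: "u \<in> Arr J" for u
    proof -
      have Fu: "onArr F u \<in> hom C (onObj F (Dom J u)) (onObj F (Cod J u))"
        using functor_hom[OF F homI[OF u refl refl]] .
      have "\<tau> (Cod J u) \<cdot> (onArr F u \<cdot> g) = \<tau> (Dom J u) \<cdot> g"
        if g: "g \<in> hom C X (onObj F (Dom J u))" for g
        using Comp_assoc[OF g Fu \<tau>[OF J.Cod_in[OF u]]] co u by (simp add: is_cocone_def)
      then show ?thesis
        using homD[OF Fu] Comp_in[OF _ Fu]
        by (auto simp: \<sigma>_def hom_ftor_def Comp_set_cat compose_def fun_eq_iff restrict_def)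
    qed
  qed
  then obtain h where h: "h \<in> hom ?S (hom C X c) I" "\<And>j. j \<in> Obj J \<Longrightarrow> h \<cdot>\<^bsub>?S\<^esub> ?\<tau> j = \<sigma> j"
    using colimS unfolding is_colimit_def by blast
  then obtain h' where h': "h = (hom C X c, h', I)" "h' \<in> hom C X c \<rightarrow>\<^sub>E I"
    by (auto simp: hom_set_cat)
  let ?k = "(hom C X c, h', hom C X c)"
  let ?i = "(hom C X c, \<lambda>x\<in>hom C X c. x, hom C X c)"
  have k: "?k \<in> hom ?S (hom C X c) (hom C X c)" "?i \<in> hom ?S (hom C X c) (hom C X c)"
    using h'(2) Isub smc by (auto simp: hom_set_cat PiE_def)
  have kj: "?k \<cdot>\<^bsub>?S\<^esub> ?\<tau> j = ?\<tau> j" "?i \<cdot>\<^bsub>?S\<^esub> ?\<tau> j = ?\<tau> j" if j: "j \<in> Obj J" for j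
    using h(2)[OF j] \<tau>S[OF j] h'(1) Comp_in[OF _ \<tau>[OF j]]
    by (auto simp: \<sigma>_def Comp_set_cat compose_def fun_eq_iff restrict_def)
  have "is_cocone J ?S ?F (hom C X c) ?\<tau>" using colimS by (simp add: is_colimit_def)
  then have "\<exists>!h. h \<in> hom ?S (hom C X c) (hom C X c) \<and> (\<forall>j\<in>Obj J. h \<cdot>\<^bsub>?S\<^esub> ?\<tau> j = ?\<tau> j)"
    using colimS unfolding is_colimit_def by blast
  then have "?k = ?i" using k kj by (metis (no_types, lifting))
  then have "h' f = f" using f by simp
  then have "f \<in> I" using PiE_mem[OF h'(2) f] by simp
  then show ?thesis unfolding I_def by blast
qed

text \<open>\<open>H\<close> is the left Kan extension of its restriction to \<open>P\<close>: a family \<open>s\<close> as below is a cocone over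
  the canonical diagram \<open>P / A \<rightarrow> D\<close>, and \<open>H A\<close> is required to be the colimit.\<close>

definition left_Kan :: "('o, 'm) cat \<Rightarrow> 'o set \<Rightarrow> ('o, 'm, 'p, 'n) ftor \<Rightarrow> ('p, 'n) cat \<Rightarrow> bool" where
  "left_Kan C P H D \<longleftrightarrow>
    (\<forall>A\<in>Obj C. \<forall>B\<in>Obj D. \<forall>s.
      (\<forall>Y\<in>P. \<forall>w\<in>hom C Y A. s w \<in> hom D (onObj H Y) B) \<and>
      (\<forall>Y\<in>P. \<forall>Z\<in>P. \<forall>w\<in>hom C Y A. \<forall>g\<in>hom C Z Y. s (w \<cdot>\<^bsub>C\<^esub> g) = s w \<cdot>\<^bsub>D\<^esub> onArr H g) \<longrightarrow>
      (\<exists>!h. h \<in> hom D (onObj H A) B \<and> (\<forall>Y\<in>P. \<forall>w\<in>hom C Y A. h \<cdot>\<^bsub>D\<^esub> onArr H w = s w)))"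

lemma left_Kan_ex1:
  assumes "left_Kan C P H D" "A \<in> Obj C" "B \<in> Obj D"
    and "\<And>Y w. Y \<in> P \<Longrightarrow> w \<in> hom C Y A \<Longrightarrow> s w \<in> hom D (onObj H Y) B"
    and "\<And>Y Z w g. Y \<in> P \<Longrightarrow> Z \<in> P \<Longrightarrow> w \<in> hom C Y A \<Longrightarrow> g \<in> hom C Z Y \<Longrightarrow>
      s (w \<cdot>\<^bsub>C\<^esub> g) = s w \<cdot>\<^bsub>D\<^esub> onArr H g"
  shows "\<exists>!h. h \<in> hom D (onObj H A) B \<and> (\<forall>Y\<in>P. \<forall>w\<in>hom C Y A. h \<cdot>\<^bsub>D\<^esub> onArr H w = s w)"
  using assms unfolding left_Kan_def by blast

text \<open>By functoriality of \<open>H\<close> the composites of \<open>k\<close> with the arrows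
  \<open>onArr H w\<close> form a compatible family. Both \<open>h\<close> and \<open>k\<close>
  induce it, so uniqueness applies.\<close>

lemma left_Kan_eqI:
  assumes L: "left_Kan C P H D" and F: "is_functor C D H" and C: "category C" "category D"
    and h: "h \<in> hom D (onObj H A) B" "k \<in> hom D (onObj H A) B" and A: "A \<in> Obj C"
    and eq: "\<And>Y w. Y \<in> P \<Longrightarrow> w \<in> hom C Y A \<Longrightarrow> h \<cdot>\<^bsub>D\<^esub> onArr H w = k \<cdot>\<^bsub>D\<^esub> onArr H w"
  shows "h = k"
proof -
  interpret C: category C by fact
  interpret D: category D by fact
  have "\<exists>!x. x \<in> hom D (onObj H A) B \<and>
      (\<forall>Y\<in>P. \<forall>w\<in>hom C Y A. x \<cdot>\<^bsub>D\<^esub> onArr H w = k \<cdot>\<^bsub>D\<^esub> onArr H w)"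
  proof (rule left_Kan_ex1[OF L A D.hom_Obj(2)[OF h(1)]])
    show "k \<cdot>\<^bsub>D\<^esub> onArr H w \<in> hom D (onObj H Y) B" if "w \<in> hom C Y A" for Y w
      using D.Comp_in[OF functor_hom[OF F that] h(2)] .
    show "k \<cdot>\<^bsub>D\<^esub> onArr H (w \<cdot>\<^bsub>C\<^esub> g) = (k \<cdot>\<^bsub>D\<^esub> onArr H w) \<cdot>\<^bsub>D\<^esub> onArr H g"
      if "w \<in> hom C Y A" "g \<in> hom C Z Y" for Y Z w g
      using D.Comp_assoc[OF functor_hom[OF F that(2)] functor_hom[OF F that(1)] h(2)]
        functor_Comp[OF F that(2,1)] by simp
  qed
  then show ?thesis using h eq by blast
qed

text \<open>A compatible family \<open>s\<close> over \<open>P\<close> restricts to a cocone over a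
  filtered diagram with colimit \<open>A\<close>. Both have the same mediating arrows, because every
  arrow from an object of \<open>P\<close> to \<open>A\<close> factors through some
  \<open>\<tau> j\<close>. The choice of factorization is immaterial, since \<open>s\<close> is
  evaluated at the composite.\<close>

lemma left_Kan_if_preserves_filtered_colimits:
  fixes U :: "'u rel"
  assumes lp: "locally_presentable U lam C" and rep: "representative_presentables U lam C P"
    and H: "is_functor C D H" "preserves_filtered_colimits U lam C D H" and D: "category D"
  shows "left_Kan C P H D"
  unfolding left_Kan_def
proof (intro ballI allI impI, elim conjE)
  fix A B s
  assume A: "A \<in> Obj C" and B: "B \<in> Obj D"
    and s: "\<forall>Y\<in>P. \<forall>w\<in>hom C Y A. s w \<in> hom D (onObj H Y) B"
    and sg: "\<forall>Y\<in>P. \<forall>Z\<in>P. \<forall>w\<in>hom C Y A. \<forall>g\<in>hom C Z Y. s (w \<cdot>\<^bsub>C\<^esub> g) = s w \<cdot>\<^bsub>D\<^esub> onArr H g"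
  interpret C: category C using lp by (simp add: locally_presentable_def)
  interpret D: category D by fact
  have ls: "locally_small U C" using lp by (simp add: locally_presentable_def)
  obtain J :: "('u, 'u) cat" and F \<tau> where J: "small_category U J" "filtered lam J"
    and F: "is_functor J C F" and FG: "\<forall>j\<in>Obj J. presentable U lam C (onObj F j)"
    and colim: "is_colimit J C F A \<tau>"
    using lp A unfolding locally_presentable_def by meson
  interpret J: category J using J by (simp add: small_category_def)
  have co: "is_cocone J C F A \<tau>" using colim by (simp add: is_colimit_def)
  have \<tau>: "\<tau> j \<in> hom C (onObj F j) A" if "j \<in> Obj J" for j
    using co that by (simp add: is_cocone_def)
  \<comment> \<open>The objects of the diagram are only isomorphic to members of \<open>P\<close>.
    One half of each isomorphism is kept, which exhibits \<open>onObj F j\<close> as a retract of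
    \<open>Y j\<close>.\<close>
  have "\<forall>j\<in>Obj J. \<exists>Y e d. Y \<in> P \<and> e \<in> hom C (onObj F j) Y \<and> d \<in> hom C Y (onObj F j) \<and>
      d \<cdot>\<^bsub>C\<^esub> e = Ide C (onObj F j)"
    using rep FG unfolding representative_presentables_def isomorphic_def iso_arr_def by meson
  then obtain Y e d where Ye: "\<forall>j\<in>Obj J. Y j \<in> P \<and> e j \<in> hom C (onObj F j) (Y j) \<and>
      d j \<in> hom C (Y j) (onObj F j) \<and> d j \<cdot>\<^bsub>C\<^esub> e j = Ide C (onObj F j)"
    by metis
  then have Y: "Y j \<in> P" and e: "e j \<in> hom C (onObj F j) (Y j)" and d: "d j \<in> hom C (Y j) (onObj F j)"
    and de: "d j \<cdot>\<^bsub>C\<^esub> e j = Ide C (onObj F j)" if "j \<in> Obj J" for j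
    using that by simp_all
  have retract: "(\<tau> j \<cdot>\<^bsub>C\<^esub> d j) \<cdot>\<^bsub>C\<^esub> (e j \<cdot>\<^bsub>C\<^esub> g) = \<tau> j \<cdot>\<^bsub>C\<^esub> g"
    if j: "j \<in> Obj J" and g: "g \<in> hom C Z (onObj F j)" for j g Z
    using C.Comp_assoc[OF g e[OF j] d[OF j]] C.Comp_assoc[OF C.Comp_in[OF g e[OF j]] d[OF j] \<tau>[OF j]]
      de[OF j] C.Ide_left[OF g] by simp
  \<comment> \<open>If \<open>onObj F j\<close> were itself in \<open>P\<close>, this would be
    \<open>s (\<tau> j)\<close>. The detour through \<open>Y j\<close> evaluates \<open>s\<close>
    only at arrows that start in \<open>P\<close>.\<close>
  define \<sigma> where "\<sigma> j = s (\<tau> j \<cdot>\<^bsub>C\<^esub> d j) \<cdot>\<^bsub>D\<^esub> onArr H (e j)" for j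
  have td: "\<tau> j \<cdot>\<^bsub>C\<^esub> d j \<in> hom C (Y j) A" if "j \<in> Obj J" for j
    using C.Comp_in d \<tau> that by blast
  have std: "s (\<tau> j \<cdot>\<^bsub>C\<^esub> d j) \<in> hom D (onObj H (Y j)) B" if "j \<in> Obj J" for j
    using s Y td that by blast
  have \<sigma>: "\<sigma> j \<in> hom D (onObj H (onObj F j)) B" if "j \<in> Obj J" for j
    unfolding \<sigma>_def using D.Comp_in[OF functor_hom[OF H(1) e[OF that]] std[OF that]] .
  have \<sigma>g: "\<sigma> j \<cdot>\<^bsub>D\<^esub> onArr H g = s (\<tau> j \<cdot>\<^bsub>C\<^esub> d j) \<cdot>\<^bsub>D\<^esub> onArr H (e j \<cdot>\<^bsub>C\<^esub> g)"
    if j: "j \<in> Obj J" and g: "g \<in> hom C Z (onObj F j)" for j g Z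
    unfolding \<sigma>_def
    using D.Comp_assoc[OF functor_hom[OF H(1) g] functor_hom[OF H(1) e[OF j]] std[OF j]]
      functor_Comp[OF H(1) g e[OF j]] by simp
  \<comment> \<open>Both \<open>Z\<close> and \<open>Y j\<close> lie in \<open>P\<close>, so
    \<open>sg\<close> applies along \<open>e j \<cdot> g\<close>, and then the retraction
    cancels.\<close>
  have \<sigma>gP: "\<sigma> j \<cdot>\<^bsub>D\<^esub> onArr H g = s (\<tau> j \<cdot>\<^bsub>C\<^esub> g)"
    if j: "j \<in> Obj J" and Z: "Z \<in> P" and g: "g \<in> hom C Z (onObj F j)" for j g Z
    using \<sigma>g[OF j g] sg Y[OF j] Z td[OF j] C.Comp_in[OF g e[OF j]] retract[OF j g] by metis
  have cone: "is_cocone J D (H \<circ>\<^sub>F F) B \<sigma>"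
    unfolding is_cocone_def
  proof (intro conjI ballI)
    show "B \<in> Obj D" by fact
    show "\<sigma> j \<in> hom D (onObj (H \<circ>\<^sub>F F) j) B" if "j \<in> Obj J" for j
      using \<sigma> that by simp
    fix u assume u: "u \<in> Arr J"
    let ?i = "Dom J u" and ?j = "Cod J u"
    have i: "?i \<in> Obj J" and j: "?j \<in> Obj J" using J.Dom_in J.Cod_in u by blast+
    have Fu: "onArr F u \<in> hom C (onObj F ?i) (onObj F ?j)"
      using functor_hom[OF F homI[OF u refl refl]] .
    have Fud: "onArr F u \<cdot>\<^bsub>C\<^esub> d ?i \<in> hom C (Y ?i) (onObj F ?j)"
      using C.Comp_in[OF d[OF i] Fu] .
    \<comment> \<open>Factoring \<open>onArr F u\<close> through \<open>Y ?i\<close> makes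
      \<open>\<sigma>gP\<close> applicable, whose arrow must start in \<open>P\<close>.\<close>
    have "onArr F u = (onArr F u \<cdot>\<^bsub>C\<^esub> d ?i) \<cdot>\<^bsub>C\<^esub> e ?i"
      using C.Comp_assoc[OF e[OF i] d[OF i] Fu] de[OF i] C.Ide_right[OF Fu] by simp
    then have "\<sigma> ?j \<cdot>\<^bsub>D\<^esub> onArr H (onArr F u) =
        \<sigma> ?j \<cdot>\<^bsub>D\<^esub> (onArr H (onArr F u \<cdot>\<^bsub>C\<^esub> d ?i) \<cdot>\<^bsub>D\<^esub> onArr H (e ?i))"
      using functor_Comp[OF H(1) e[OF i] Fud] by simp
    also have "\<dots> = s (\<tau> ?j \<cdot>\<^bsub>C\<^esub> (onArr F u \<cdot>\<^bsub>C\<^esub> d ?i)) \<cdot>\<^bsub>D\<^esub> onArr H (e ?i)"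
      using D.Comp_assoc[OF functor_hom[OF H(1) e[OF i]] functor_hom[OF H(1) Fud] \<sigma>[OF j]]
        \<sigma>gP[OF j Y[OF i] Fud] by simp
    also have "\<tau> ?j \<cdot>\<^bsub>C\<^esub> (onArr F u \<cdot>\<^bsub>C\<^esub> d ?i) = \<tau> ?i \<cdot>\<^bsub>C\<^esub> d ?i"
      using C.Comp_assoc[OF d[OF i] Fu \<tau>[OF j]] co u by (simp add: is_cocone_def)
    finally show "\<sigma> ?j \<cdot>\<^bsub>D\<^esub> onArr (H \<circ>\<^sub>F F) u = \<sigma> ?i"
      by (simp add: \<sigma>_def)
  qed
  have colimH: "is_colimit J D (H \<circ>\<^sub>F F) (onObj H A) (\<lambda>j. onArr H (\<tau> j))"
    using H(2) J F colim unfolding preserves_filtered_colimits_def by blast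
  then have ex1: "\<exists>!h. h \<in> hom D (onObj H A) B \<and> (\<forall>j\<in>Obj J. h \<cdot>\<^bsub>D\<^esub> onArr H (\<tau> j) = \<sigma> j)"
    using cone unfolding is_colimit_def by blast
  \<comment> \<open>For each \<open>h\<close>, mediating \<open>\<sigma>\<close> over the diagram is
    equivalent to inducing \<open>s\<close> on all of \<open>P\<close>, so unique existence carries
    over from \<open>ex1\<close>.\<close>
  have iff: "(\<forall>j\<in>Obj J. h \<cdot>\<^bsub>D\<^esub> onArr H (\<tau> j) = \<sigma> j) \<longleftrightarrow>
      (\<forall>Y\<in>P. \<forall>w\<in>hom C Y A. h \<cdot>\<^bsub>D\<^esub> onArr H w = s w)" if h: "h \<in> hom D (onObj H A) B" for h
  proof (intro iffI ballI)
    fix Z w assume hj: "\<forall>j\<in>Obj J. h \<cdot>\<^bsub>D\<^esub> onArr H (\<tau> j) = \<sigma> j" and Z: "Z \<in> P" and w: "w \<in> hom C Z A"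
    have "presentable U lam C Z" using rep Z by (simp add: representative_presentables_def)
    from C.presentable_factor[OF ls this J F colim w]
    obtain j g where j: "j \<in> Obj J" and g: "g \<in> hom C Z (onObj F j)" and wg: "w = \<tau> j \<cdot>\<^bsub>C\<^esub> g"
      by blast
    have "h \<cdot>\<^bsub>D\<^esub> onArr H w = \<sigma> j \<cdot>\<^bsub>D\<^esub> onArr H g"
      using D.Comp_assoc[OF functor_hom[OF H(1) g] functor_hom[OF H(1) \<tau>[OF j]] h]
        functor_Comp[OF H(1) g \<tau>[OF j]] hj j wg by simp
    then show "h \<cdot>\<^bsub>D\<^esub> onArr H w = s w" using \<sigma>gP[OF j Z g] wg by simp
  next
    fix j assume hw: "\<forall>Y\<in>P. \<forall>w\<in>hom C Y A. h \<cdot>\<^bsub>D\<^esub> onArr H w = s w" and j: "j \<in> Obj J"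
    have "\<tau> j = (\<tau> j \<cdot>\<^bsub>C\<^esub> d j) \<cdot>\<^bsub>C\<^esub> e j"
      using C.Comp_assoc[OF e[OF j] d[OF j] \<tau>[OF j]] de[OF j] C.Ide_right[OF \<tau>[OF j]] by simp
    then have "h \<cdot>\<^bsub>D\<^esub> onArr H (\<tau> j) = (h \<cdot>\<^bsub>D\<^esub> onArr H (\<tau> j \<cdot>\<^bsub>C\<^esub> d j)) \<cdot>\<^bsub>D\<^esub> onArr H (e j)"
      using D.Comp_assoc[OF functor_hom[OF H(1) e[OF j]] functor_hom[OF H(1) td[OF j]] h]
        functor_Comp[OF H(1) e[OF j] td[OF j]] by simp
    then show "h \<cdot>\<^bsub>D\<^esub> onArr H (\<tau> j) = \<sigma> j"
      using hw Y[OF j] td[OF j] by (simp add: \<sigma>_def)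
  qed
  show "\<exists>!h. h \<in> hom D (onObj H A) B \<and> (\<forall>Y\<in>P. \<forall>w\<in>hom C Y A. h \<cdot>\<^bsub>D\<^esub> onArr H w = s w)"
    using ex1 iff by (metis (no_types, lifting))
qed

section \<open>Concrete categories\<close>

lemma concrete_cat_simps:
  "Obj (concrete_cat C S R) = S"
  "Arr (concrete_cat C S R) = {(a, h, b). a \<in> S \<and> b \<in> S \<and> h \<in> hom C (fst a) (fst b) \<and> R a b h}"
  "Dom (concrete_cat C S R) (a, h, b) = a"
  "Cod (concrete_cat C S R) (a, h, b) = b"
  "Ide (concrete_cat C S R) a = (a, Ide C (fst a), a)"
  "(b', k, c) \<cdot>\<^bsub>concrete_cat C S R\<^esub> (a, h, b) = (a, k \<cdot>\<^bsub>C\<^esub> h, c)"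
  by (simp_all add: concrete_cat_def)

lemma hom_concrete_cat:
  "hom (concrete_cat C S R) a b =
    {(a, h, b) | h. a \<in> S \<and> b \<in> S \<and> h \<in> hom C (fst a) (fst b) \<and> R a b h}"
  by (auto simp: hom_def[of "concrete_cat C S R"] concrete_cat_simps)

definition concrete_ftor :: "('o \<times> 's \<Rightarrow> 'o \<times> 'r) \<Rightarrow>
    ('o \<times> 's, ('o \<times> 's) \<times> 'm \<times> ('o \<times> 's), 'o \<times> 'r, ('o \<times> 'r) \<times> 'm \<times> ('o \<times> 'r)) ftor" where
  "concrete_ftor \<Phi> = \<lparr>onObj = \<Phi>, onArr = (\<lambda>(a, h, b). (\<Phi> a, h, \<Phi> b))\<rparr>"

lemma is_functor_concrete_ftor:
  assumes "\<And>a. a \<in> S \<Longrightarrow> \<Phi> a \<in> S'" "\<And>a. a \<in> S \<Longrightarrow> fst (\<Phi> a) = fst a"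
    and "\<And>a b h. a \<in> S \<Longrightarrow> b \<in> S \<Longrightarrow> h \<in> hom C (fst a) (fst b) \<Longrightarrow> R a b h \<Longrightarrow> R' (\<Phi> a) (\<Phi> b) h"
  shows "is_functor (concrete_cat C S R) (concrete_cat C S' R') (concrete_ftor \<Phi>)"
  using assms unfolding is_functor_def
  by (auto simp: concrete_ftor_def hom_concrete_cat concrete_cat_simps)

lemma forget_concrete_ftor:
  assumes "\<And>a. a \<in> S \<Longrightarrow> fst (\<Phi> a) = fst a"
  shows "ftor_eq_on (concrete_cat C S R) (forget \<circ>\<^sub>F concrete_ftor \<Phi>) forget"
  using assms by (auto simp: ftor_eq_on_def concrete_ftor_def forget_def concrete_cat_simps)

lemma (in category) nat_isomorphic_concrete_ftor_id:
  assumes "\<And>a. a \<in> S \<Longrightarrow> fst a \<in> Obj C" "\<And>a. a \<in> S \<Longrightarrow> R a a (Ide C (fst a))"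
    and "\<And>a. a \<in> S \<Longrightarrow> \<Psi> (\<Phi> a) = a"
  shows "nat_isomorphic (concrete_cat C S R) (concrete_cat C S R)
    (concrete_ftor \<Psi> \<circ>\<^sub>F concrete_ftor \<Phi>) ftor_id"
proof -
  have I: "Ide C (fst a) \<in> hom C (fst a) (fst a)" if "a \<in> S" for a
    using Ide_in assms(1) that by blast
  let ?E = "concrete_cat C S R"
  have hom: "(a, Ide C (fst a), a) \<in> hom ?E a a" if "a \<in> S" for a
    using assms(2) I that by (simp add: hom_concrete_cat)
  have "iso_arr ?E a a (a, Ide C (fst a), a)" if a: "a \<in> S" for a
    unfolding iso_arr_def using hom[OF a]
    by (intro conjI bexI[of _ "(a, Ide C (fst a), a)"]) (simp_all add: concrete_cat_simps Ide_left[OF I[OF a]])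
  then show ?thesis
    unfolding nat_isomorphic_def is_nat_trans_def using hom
    by (intro exI[of _ "\<lambda>a. (a, Ide C (fst a), a)"])
      (auto simp: concrete_cat_simps concrete_ftor_def ftor_comp_def ftor_id_def
        assms(3) Ide_left Ide_right)
qed

text \<open>Such a bijection is even an isomorphism of concrete categories: the functor given by
  \<open>inv_into\<close> is a strict inverse, so both natural isomorphisms have identity
  components.\<close>

lemma (in category) concretely_equivalent_concrete_cat:
  assumes bij: "bij_betw \<Phi> S S'" and Obj: "\<And>a. a \<in> S \<Longrightarrow> fst a \<in> Obj C"
    and fst: "\<And>a. a \<in> S \<Longrightarrow> fst (\<Phi> a) = fst a"
    and Ide: "\<And>a. a \<in> S \<Longrightarrow> R a a (Ide C (fst a))"
    and iff: "\<And>a b h. a \<in> S \<Longrightarrow> b \<in> S \<Longrightarrow> h \<in> hom C (fst a) (fst b) \<Longrightarrow>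
      R a b h \<longleftrightarrow> R' (\<Phi> a) (\<Phi> b) h"
  shows "concretely_equivalent (concrete_cat C S R) forget (concrete_cat C S' R') forget"
proof -
  define \<Psi> where "\<Psi> = inv_into S \<Phi>"
  have 1: "\<Phi> a \<in> S'" "\<Psi> (\<Phi> a) = a" if "a \<in> S" for a
    using bij that by (auto simp: \<Psi>_def bij_betw_def)
  have 2: "\<Psi> b \<in> S" "\<Phi> (\<Psi> b) = b" if "b \<in> S'" for b
    using bij that by (auto simp: \<Psi>_def bij_betw_def inv_into_into f_inv_into_f)
  have 3: "fst (\<Psi> b) = fst b" if "b \<in> S'" for b
    using fst[OF 2(1)[OF that]] 2(2)[OF that] by simp
  have 4: "R' b b (Ide C (fst b))" if "b \<in> S'" for b
    using iff[OF 2(1)[OF that] 2(1)[OF that]] Ide[OF 2(1)[OF that]] Ide_in[OF Obj[OF 2(1)[OF that]]]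
      2(2)[OF that] 3[OF that] by simp
  have 5: "is_functor (concrete_cat C S R) (concrete_cat C S' R') (concrete_ftor \<Phi>)"
    using 1 fst iff by (intro is_functor_concrete_ftor) auto
  have 6: "is_functor (concrete_cat C S' R') (concrete_cat C S R) (concrete_ftor \<Psi>)"
    using 2 3 iff by (intro is_functor_concrete_ftor) auto
  have 7: "fst b \<in> Obj C" if "b \<in> S'" for b using Obj[OF 2(1)] 3 that by simp
  have "nat_isomorphic (concrete_cat C S R) (concrete_cat C S R)
      (concrete_ftor \<Psi> \<circ>\<^sub>F concrete_ftor \<Phi>) ftor_id"
    using Obj Ide 1(2) by (rule nat_isomorphic_concrete_ftor_id)
  moreover have "nat_isomorphic (concrete_cat C S' R') (concrete_cat C S' R')
      (concrete_ftor \<Phi> \<circ>\<^sub>F concrete_ftor \<Psi>) ftor_id"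
    using 7 4 2(2) by (rule nat_isomorphic_concrete_ftor_id)
  moreover have "ftor_eq_on (concrete_cat C S R) (forget \<circ>\<^sub>F concrete_ftor \<Phi>) forget"
    using fst by (rule forget_concrete_ftor)
  moreover have "ftor_eq_on (concrete_cat C S' R') (forget \<circ>\<^sub>F concrete_ftor \<Psi>) forget"
    using 3 by (rule forget_concrete_ftor)
  ultimately show ?thesis
    unfolding concretely_equivalent_def using 5 6 by blast
qed

section \<open>Terms, equations and their satisfaction\<close>

lemma has_arity_arities:
  assumes "is_type U C S t" "has_arity C S t p X Y"
  shows "X \<in> S" "Y \<in> S"
proof -
  have "X \<in> S \<and> Y \<in> S"
    using assms(2,1) by induction (auto simp: is_type_def ops_of_def Pi_iff)
  then show "X \<in> S" "Y \<in> S" by simp_all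
qed

text \<open>Needed because \<open>satisfies\<close> quantifies over every arity at which two classes
  are terms. The arity of \<open>Var f\<close> is recovered from the domain and codomain of
  \<open>f\<close>.\<close>

lemma has_arity_unique:
  "has_arity C S t p X Y \<Longrightarrow> has_arity C S t p X' Y' \<Longrightarrow> X = X' \<and> Y = Y'"
proof (induction arbitrary: X' Y' rule: has_arity.induct)
  case (has_arity_Op \<omega> X Y)
  then show ?case by (auto simp: ops_of_def elim: has_arity.cases)
next
  case (has_arity_Var X Y f)
  then show ?case by (auto simp: hom_def elim: has_arity.cases)
next
  case (has_arity_Seq p X Y q Z)
  from has_arity_Seq.prems show ?case
    by cases (use has_arity_Seq.IH in blast)
qed

text \<open>The identity laws are the delicate cases: \<open>Var (Ide C Y)\<close> has an arity only
  for \<open>Y\<close> in \<open>S\<close>, which holds because operations have their arities in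
  \<open>S\<close>.\<close>

lemma (in category) identified_has_arity:
  assumes "is_type U C S t" "identified C S t X Y p q"
  shows "has_arity C S t p X Y" "has_arity C S t q X Y"
proof -
  have S: "X \<in> Obj C" if "X \<in> S" for X using assms(1) that by (auto simp: is_type_def)
  have "has_arity C S t p X Y \<and> has_arity C S t q X Y"
    using assms(2)
  proof induction
    case (identified_Var_Comp X Y Z f g)
    then show ?case using Comp_in by (blast intro: has_arity.intros)
  next
    case (identified_Ide_left p X Y)
    then have "Y \<in> S" using has_arity_arities[OF assms(1)] by blast
    then show ?case using identified_Ide_left Ide_in S by (blast intro: has_arity.intros)
  next
    case (identified_Ide_right p X Y)
    then have "X \<in> S" using has_arity_arities[OF assms(1)] by blast
    then show ?case using identified_Ide_right Ide_in S by (blast intro: has_arity.intros)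
  qed (blast intro: has_arity.intros)+
  then show "has_arity C S t p X Y" "has_arity C S t q X Y" by simp_all
qed

lemma (in category) interp_hom:
  assumes "(A, \<phi>) \<in> algebras C t" "has_arity C S t p X Y"
  shows "f \<in> hom C X A \<Longrightarrow> interp C \<phi> p f \<in> hom C Y A"
  using assms(2)
proof (induction arbitrary: f)
  case (has_arity_Op \<omega> X Y)
  then have "\<phi> \<omega> \<in> hom C X A \<rightarrow>\<^sub>E hom C Y A"
    using assms(1) by (force simp: algebras_def ops_of_def)
  then show ?case using has_arity_Op by auto
qed (auto intro: Comp_in)

text \<open>The composition and identity rules for variables become associativity and unit laws in
  \<open>C\<close>; reassociating \<open>Seq\<close> does not change the interpretation at
  all.\<close>

lemma (in category) identified_interp:
  assumes "is_type U C S t" "(A, \<phi>) \<in> algebras C t" "identified C S t X Y p q"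
  shows "f \<in> hom C X A \<Longrightarrow> interp C \<phi> p f = interp C \<phi> q f"
  using assms(3)
proof (induction arbitrary: f)
  case (identified_cong X Y p p' Z q q')
  then show ?case
    using interp_hom[OF assms(2) identified_has_arity(2)[OF assms(1) identified_cong.hyps(1)]] by simp
next
  case (identified_Var_Comp X Y Z g h)
  then show ?case by (simp add: Comp_assoc)
next
  case (identified_Ide_left p X Y)
  then show ?case
    using Ide_right[OF interp_hom[OF assms(2) identified_Ide_left.hyps identified_Ide_left.prems]] by simp
next
  case (identified_Ide_right p X Y)
  then show ?case by (simp add: Ide_right)
qed simp_all

section \<open>Equations between preterms and the theory of a class of algebras\<close>

definition equation :: "('o, 'm) cat \<Rightarrow> 'o set \<Rightarrow> ('o, 'w) optype \<Rightarrow> 'o \<Rightarrow> 'o \<Rightarrow>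
    ('w, 'm) preterm \<Rightarrow> ('w, 'm) preterm \<Rightarrow> ('w, 'm) preterm set \<times> ('w, 'm) preterm set" where
  "equation C S t X Y p q = (Collect (identified C S t X Y p), Collect (identified C S t X Y q))"

lemma identified_class_in_terms:
  "has_arity C S t p X Y \<Longrightarrow> Collect (identified C S t X Y p) \<in> terms C S t X Y"
  unfolding terms_def quotient_def by auto

lemma (in category) terms_has_arity:
  "is_type U C S t \<Longrightarrow> P \<in> terms C S t X Y \<Longrightarrow> p \<in> P \<Longrightarrow> has_arity C S t p X Y"
  by (auto simp: terms_def quotient_def dest: identified_has_arity)

text \<open>Soundness of the identifications allows all representatives of the two classes to be
  replaced by \<open>p\<close> and \<open>q\<close>.\<close>

lemma (in category) satisfies_equation_iff:
  assumes t: "is_type U C S t" and A: "(A, \<phi>) \<in> algebras C t"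
    and p: "has_arity C S t p X Y" and q: "has_arity C S t q X Y"
  shows "satisfies C S t (A, \<phi>) (equation C S t X Y p q) \<longleftrightarrow>
    (\<forall>f\<in>hom C X A. interp C \<phi> p f = interp C \<phi> q f)" (is "?L \<longleftrightarrow> ?R")
proof
  note refl = identified_refl[OF p] identified_refl[OF q]
  show ?R if ?L
    using that refl has_arity_arities[OF t p] identified_class_in_terms[OF p] identified_class_in_terms[OF q]
    unfolding satisfies_def equation_def by blast
  show ?L if R: ?R
    unfolding satisfies_def equation_def prod.case
  proof (intro ballI impI, elim conjE)
    fix X' Y' p' q' f
    assume f: "f \<in> hom C X' A" and p': "p' \<in> Collect (identified C S t X Y p)"
      and q': "q' \<in> Collect (identified C S t X Y q)"
      and T: "Collect (identified C S t X Y p) \<in> terms C S t X' Y'"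
    \<comment> \<open>A priori the class could be a term of a different arity; it contains
      \<open>p\<close>, which fixes the arity.\<close>
    have "X' = X"
      using has_arity_unique[OF p terms_has_arity[OF t T]] refl by simp
    then have f: "f \<in> hom C X A" using f by simp
    then show "interp C \<phi> p' f = interp C \<phi> q' f"
      using R p' q' identified_interp[OF t A _ f] by (metis mem_Collect_eq)
  qed
qed

text \<open>Taking every equation valid in \<open>M\<close> makes the members of \<open>M\<close>
  models by construction, and any particular law holds in all models once it is checked in
  \<open>M\<close>.\<close>

definition theory_of :: "('o, 'm) cat \<Rightarrow> 'o set \<Rightarrow> ('o, 'w) optype \<Rightarrow> ('o \<times> ('w \<Rightarrow> 'm \<Rightarrow> 'm)) set \<Rightarrow>
    (('w, 'm) preterm set \<times> ('w, 'm) preterm set) set" where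
  "theory_of C S t M = {equation C S t X Y p q | X Y p q.
    has_arity C S t p X Y \<and> has_arity C S t q X Y \<and>
    (\<forall>(A, \<phi>)\<in>M. \<forall>f\<in>hom C X A. interp C \<phi> p f = interp C \<phi> q f)}"

lemma is_equational_theory_theory_of:
  assumes "is_type U C S t"
  shows "is_equational_theory C S t (theory_of C S t M)"
  unfolding is_equational_theory_def theory_of_def
proof (clarify, goal_cases)
  case (1 _ _ X Y p q)
  then show ?case
    using has_arity_arities[OF assms, of p X Y] identified_class_in_terms[of C S t p X Y] identified_class_in_terms[of C S t q X Y]
    by (auto simp: equation_def)
qed

lemma (in category) satisfies_theory_of:
  assumes "is_type U C S t" "M \<subseteq> algebras C t" "\<A> \<in> M" "e \<in> theory_of C S t M"
  shows "satisfies C S t \<A> e"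
proof (cases \<A>)
  case (Pair A \<phi>)
  then have "(A, \<phi>) \<in> algebras C t" using assms by auto
  then show ?thesis
    using assms(3,4) satisfies_equation_iff[OF assms(1)] unfolding theory_of_def Pair by fastforce
qed

lemma (in category) interp_eq_if_satisfies_theory_of:
  assumes t: "is_type U C S t" and A: "(A, \<phi>) \<in> algebras C t"
    and sat: "\<forall>e\<in>theory_of C S t M. satisfies C S t (A, \<phi>) e"
    and p: "has_arity C S t p X Y" "has_arity C S t q X Y"
    and M: "\<And>B \<psi> f. (B, \<psi>) \<in> M \<Longrightarrow> f \<in> hom C X B \<Longrightarrow> interp C \<psi> p f = interp C \<psi> q f"
    and f: "f \<in> hom C X A"
  shows "interp C \<phi> p f = interp C \<phi> q f"
proof -
  have "equation C S t X Y p q \<in> theory_of C S t M"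
    unfolding theory_of_def using p M by blast
  then show ?thesis
    using sat satisfies_equation_iff[OF t A p] f by blast
qed

section \<open>The equational theory of a monad\<close>

text \<open>Operation symbols have to live in a prescribed type, hence the encoding
  \<open>enc\<close>. It acts on pairs because the codomain of \<open>w\<close> determines
  \<open>onObj (endo T) X\<close> but possibly not \<open>X\<close>.\<close>

locale monad_presentation = category C for C :: "('o, 'm) cat" (structure) +
  fixes U :: "'u rel" and T :: "('o, 'm) monad" and P :: "'o set" and enc :: "'o \<times> 'm \<Rightarrow> 'w"
  assumes homs_small: "locally_small U C"
    and monad: "is_monad C T"
    and P_Obj: "P \<subseteq> Obj C"
    and Kan_id: "left_Kan C P ftor_id C"
    and Kan_T: "left_Kan C P (endo T) C"
    and Kan_TT: "left_Kan C P (endo T \<circ>\<^sub>F endo T) C"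
    and inj_enc: "inj_on enc {(X, w). X \<in> P \<and> w \<in> Arr C \<and> Dom C w \<in> P \<and> Cod C w = onObj (endo T) X}"
begin

abbreviation "TO \<equiv> onObj (endo T)"
abbreviation "TA \<equiv> onArr (endo T)"
abbreviation "\<eta> \<equiv> unt T"
abbreviation "\<mu> \<equiv> mlt T"

lemma P_in: "X \<in> P \<Longrightarrow> X \<in> Obj C"
  using P_Obj by blast

lemma T_functor: "is_functor C C (endo T)"
  using monad by (simp add: is_monad_def)

lemmas T_hom = functor_hom[OF T_functor]
  and T_Comp = functor_Comp[OF T_functor]
  and T_Obj = functor_Obj[OF T_functor]

lemma eta_hom: "X \<in> Obj C \<Longrightarrow> \<eta> X \<in> hom C X (TO X)"
  using monad by (simp add: is_monad_def is_nat_trans_def)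

lemma mu_hom: "X \<in> Obj C \<Longrightarrow> \<mu> X \<in> hom C (TO (TO X)) (TO X)"
  using monad by (simp add: is_monad_def is_nat_trans_def)

lemma eta_natural: "f \<in> hom C X Y \<Longrightarrow> TA f \<cdot> \<eta> X = \<eta> Y \<cdot> f"
  using monad by (auto simp: is_monad_def is_nat_trans_def hom_def)

lemma mu_natural: "f \<in> hom C X Y \<Longrightarrow> TA f \<cdot> \<mu> X = \<mu> Y \<cdot> TA (TA f)"
  using monad by (auto simp: is_monad_def is_nat_trans_def hom_def)

section \<open>Testing equality of arrows out of \<open>A\<close>, \<open>TO A\<close> and
  \<open>TO (TO A)\<close> on objects of \<open>P\<close>\<close>

lemma eqI_on_P:
  assumes "h \<in> hom C A B" "k \<in> hom C A B"
    and "\<And>X f. X \<in> P \<Longrightarrow> f \<in> hom C X A \<Longrightarrow> h \<cdot> f = k \<cdot> f"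
  shows "h = k"
  using left_Kan_eqI[OF Kan_id is_functor_id category_axioms category_axioms, of h A B k]
    assms hom_Obj(1)[OF assms(1)] by simp

text \<open>\<open>Kan_T\<close> reduces the comparison to the arrows \<open>TA f\<close>, and
  \<open>eqI_on_P\<close> then tests it on arrows \<open>w\<close> into \<open>TO X\<close>. The
  composites \<open>TA f \<cdot> w\<close> are what the operation symbols evaluate.\<close>

lemma eqI_on_TP:
  assumes h: "h \<in> hom C (TO A) B" and k: "k \<in> hom C (TO A) B" and A: "A \<in> Obj C"
    and eq: "\<And>X Y f w. X \<in> P \<Longrightarrow> Y \<in> P \<Longrightarrow> f \<in> hom C X A \<Longrightarrow> w \<in> hom C Y (TO X) \<Longrightarrow>
      h \<cdot> (TA f \<cdot> w) = k \<cdot> (TA f \<cdot> w)"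
  shows "h = k"
proof (rule left_Kan_eqI[OF Kan_T T_functor category_axioms category_axioms h k A])
  fix X f assume X: "X \<in> P" and f: "f \<in> hom C X A"
  show "h \<cdot> TA f = k \<cdot> TA f"
  proof (rule eqI_on_P[OF Comp_in[OF T_hom[OF f] h] Comp_in[OF T_hom[OF f] k]])
    fix Y w assume Y: "Y \<in> P" and w: "w \<in> hom C Y (TO X)"
    show "h \<cdot> TA f \<cdot> w = k \<cdot> TA f \<cdot> w"
      using eq[OF X Y f w] Comp_assoc[OF w T_hom[OF f] h] Comp_assoc[OF w T_hom[OF f] k] by simp
  qed
qed

text \<open>\<open>Kan_TT\<close> reduces the comparison to the arrows \<open>TA (TA f)\<close>; the
  rest is \<open>eqI_on_TP\<close> with \<open>TO X\<close> in place of \<open>A\<close>.\<close>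

lemma eqI_on_TTP:
  assumes h: "h \<in> hom C (TO (TO A)) B" and k: "k \<in> hom C (TO (TO A)) B" and A: "A \<in> Obj C"
    and eq: "\<And>X Y Z f w v. X \<in> P \<Longrightarrow> Y \<in> P \<Longrightarrow> Z \<in> P \<Longrightarrow> f \<in> hom C X A \<Longrightarrow> w \<in> hom C Y (TO X) \<Longrightarrow>
      v \<in> hom C Z (TO Y) \<Longrightarrow> h \<cdot> (TA (TA f) \<cdot> (TA w \<cdot> v)) = k \<cdot> (TA (TA f) \<cdot> (TA w \<cdot> v))"
  shows "h = k"
proof (rule left_Kan_eqI[OF Kan_TT is_functor_comp[OF T_functor T_functor] category_axioms category_axioms _ _ A])
  show "h \<in> hom C (onObj (endo T \<circ>\<^sub>F endo T) A) B" "k \<in> hom C (onObj (endo T \<circ>\<^sub>F endo T) A) B"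
    using h k by simp_all
  fix X f assume X: "X \<in> P" and f: "f \<in> hom C X A"
  note f' = T_hom[OF T_hom[OF f]]
  have "h \<cdot> TA (TA f) = k \<cdot> TA (TA f)"
  proof (rule eqI_on_TP[OF Comp_in[OF f' h] Comp_in[OF f' k] T_Obj[OF P_in[OF X]]])
    fix Y Z w v assume "Y \<in> P" "Z \<in> P" and w: "w \<in> hom C Y (TO X)" and v: "v \<in> hom C Z (TO Y)"
    then show "h \<cdot> TA (TA f) \<cdot> (TA w \<cdot> v) = k \<cdot> TA (TA f) \<cdot> (TA w \<cdot> v)"
      using eq[OF X _ _ f w v] Comp_assoc[OF Comp_in[OF v T_hom[OF w]] f'] h k by simp
  qed
  then show "h \<cdot> onArr (endo T \<circ>\<^sub>F endo T) f = k \<cdot> onArr (endo T \<circ>\<^sub>F endo T) f" by simp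
qed

section \<open>Operation symbols and their action on Eilenberg-Moore algebras\<close>

definition symbols :: "('o \<times> 'm) set" where
  "symbols = {(X, w). X \<in> P \<and> w \<in> Arr C \<and> Dom C w \<in> P \<and> Cod C w = TO X}"

text \<open>The symbols of arity \<open>(X, Y)\<close> encode the Kleisli arrows from
  \<open>Y\<close> to \<open>X\<close>; \<open>inv_into\<close> undoes the encoding.\<close>

definition sig :: "('o, 'w) optype" where
  "sig = \<lparr>Ops = enc ` symbols,
    arity = (\<lambda>\<omega>. case inv_into symbols enc \<omega> of (X, w) \<Rightarrow> (X, Dom C w))\<rparr>"

lemma dec_enc: "s \<in> symbols \<Longrightarrow> inv_into symbols enc (enc s) = s"
  using inj_enc by (simp add: symbols_def)

lemma symbolsI: "X \<in> P \<Longrightarrow> Y \<in> P \<Longrightarrow> w \<in> hom C Y (TO X) \<Longrightarrow> (X, w) \<in> symbols"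
  by (simp add: symbols_def hom_def)

lemma arity_enc: "X \<in> P \<Longrightarrow> Y \<in> P \<Longrightarrow> w \<in> hom C Y (TO X) \<Longrightarrow> arity sig (enc (X, w)) = (X, Y)"
  using homD(2)[of w C Y "TO X"] by (simp add: sig_def dec_enc symbolsI)

lemma enc_in_ops: "X \<in> P \<Longrightarrow> Y \<in> P \<Longrightarrow> w \<in> hom C Y (TO X) \<Longrightarrow> enc (X, w) \<in> ops_of sig X Y"
  using symbolsI[of X Y w] by (simp add: ops_of_def arity_enc) (simp add: sig_def)

lemma enc_in_Ops: "X \<in> P \<Longrightarrow> Y \<in> P \<Longrightarrow> w \<in> hom C Y (TO X) \<Longrightarrow> enc (X, w) \<in> Ops sig"
  using enc_in_ops by (simp add: ops_of_def)

lemma Ops_cases: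
  assumes "\<omega> \<in> Ops sig"
  obtains X Y w where "X \<in> P" "Y \<in> P" "w \<in> hom C Y (TO X)" "\<omega> = enc (X, w)"
  using assms by (auto simp: sig_def symbols_def hom_def)

text \<open>Smallness comes from local smallness, since the symbols of a given arity lie in the
  image of one hom-set.\<close>

lemma is_type_sig: "is_type U C P sig"
  unfolding is_type_def
proof (intro conjI ballI funcsetI)
  show "P \<subseteq> Obj C" by (rule P_Obj)
  show "arity sig \<omega> \<in> P \<times> P" if "\<omega> \<in> Ops sig" for \<omega>
    using that by (elim Ops_cases) (simp add: arity_enc)
  fix X Y assume X: "X \<in> P" and Y: "Y \<in> P"
  have "ops_of sig X Y \<subseteq> (\<lambda>w. enc (X, w)) ` hom C Y (TO X)"
  proof
    fix \<omega> assume "\<omega> \<in> ops_of sig X Y"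
    then have "\<omega> \<in> Ops sig" "arity sig \<omega> = (X, Y)" by (simp_all add: ops_of_def)
    then show "\<omega> \<in> (\<lambda>w. enc (X, w)) ` hom C Y (TO X)"
      by (elim Ops_cases) (auto simp: arity_enc)
  qed
  moreover have "small U ((\<lambda>w. enc (X, w)) ` hom C Y (TO X))"
    using homs_small P_in[OF Y] T_Obj[OF P_in[OF X]] card_of_image ordLeq_ordLess_trans
    unfolding locally_small_def small_def by blast
  ultimately show "small U (ops_of sig X Y)" by (rule small_subset[rotated])
qed

text \<open>The symbol \<open>enc (X, w)\<close> with \<open>w : Y \<rightarrow> T X\<close> acts on an Eilenberg--Moore algebra \<open>(A, a)\<close> by
  sending \<open>f : X \<rightarrow> A\<close> to \<open>a \<cdot> T f \<cdot> w : Y \<rightarrow> A\<close>.\<close>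

definition alg_of :: "'o \<times> 'm \<Rightarrow> 'o \<times> ('w \<Rightarrow> 'm \<Rightarrow> 'm)" where
  "alg_of = (\<lambda>(A, a). (A, \<lambda>\<omega>\<in>Ops sig. case inv_into symbols enc \<omega> of (X, w) \<Rightarrow>
    \<lambda>f\<in>hom C X A. a \<cdot> (TA f \<cdot> w)))"

lemma fst_alg_of [simp]: "fst (alg_of (A, a)) = A"
  by (simp add: alg_of_def)

lemma alg_of_enc:
  assumes "X \<in> P" "Y \<in> P" "w \<in> hom C Y (TO X)"
  shows "snd (alg_of (A, a)) (enc (X, w)) = (\<lambda>f\<in>hom C X A. a \<cdot> (TA f \<cdot> w))"
  using enc_in_Ops[OF assms] dec_enc[OF symbolsI[OF assms]] by (simp add: alg_of_def)

lemma alg_of_in_algebras: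
  assumes A: "A \<in> Obj C" and a: "a \<in> hom C (TO A) A"
  shows "alg_of (A, a) \<in> algebras C sig"
proof -
  have "snd (alg_of (A, a)) \<omega> \<in> hom C (fst (arity sig \<omega>)) A \<rightarrow>\<^sub>E hom C (snd (arity sig \<omega>)) A"
    if "\<omega> \<in> Ops sig" for \<omega>
    using that
  proof (cases rule: Ops_cases)
    case (1 X Y w)
    show ?thesis
      unfolding 1(4) arity_enc[OF 1(1-3)] alg_of_enc[OF 1(1-3)]
      using Comp_in[OF Comp_in[OF 1(3) T_hom] a] by auto
  qed
  then have "snd (alg_of (A, a)) \<in>
      (\<Pi>\<^sub>E \<omega>\<in>Ops sig. hom C (fst (arity sig \<omega>)) A \<rightarrow>\<^sub>E hom C (snd (arity sig \<omega>)) A)"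
    by (rule PiE_I) (simp_all add: alg_of_def)
  then show ?thesis
    using A by (simp add: algebras_def alg_of_def)
qed

section \<open>The theory of all Eilenberg-Moore algebras\<close>

definition em_algs :: "('o \<times> 'm) set" where
  "em_algs = {(A, a). A \<in> Obj C \<and> a \<in> hom C (TO A) A \<and> a \<cdot> \<eta> A = Ide C A \<and> a \<cdot> \<mu> A = a \<cdot> TA a}"

definition em_theory where
  "em_theory = theory_of C P sig (alg_of ` em_algs)"

lemma alg_of_em_algs: "alg_of ` em_algs \<subseteq> algebras C sig"
  using alg_of_in_algebras by (auto simp: em_algs_def)

text \<open>The device behind all laws of the operations below: an equation is checked in an
  Eilenberg-Moore algebra \<open>(B, b)\<close>, where the laws of \<open>b\<close> are at hand, and
  then holds in the arbitrary model \<open>(A, \<phi>)\<close>.\<close>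

lemma em_equation:
  assumes "(A, \<phi>) \<in> algebras C sig" "\<forall>e\<in>em_theory. satisfies C P sig (A, \<phi>) e"
    and "has_arity C P sig p X Y" "has_arity C P sig q X Y"
    and "\<And>B b f. B \<in> Obj C \<Longrightarrow> b \<in> hom C (TO B) B \<Longrightarrow> b \<cdot> \<eta> B = Ide C B \<Longrightarrow> b \<cdot> \<mu> B = b \<cdot> TA b \<Longrightarrow>
      f \<in> hom C X B \<Longrightarrow> interp C (snd (alg_of (B, b))) p f = interp C (snd (alg_of (B, b))) q f"
    and "f \<in> hom C X A"
  shows "interp C \<phi> p f = interp C \<phi> q f"
proof (rule interp_eq_if_satisfies_theory_of[OF is_type_sig assms(1) _ assms(3,4) _ assms(6)])
  show "\<forall>e\<in>theory_of C P sig (alg_of ` em_algs). satisfies C P sig (A, \<phi>) e"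
    using assms(2) by (simp add: em_theory_def)
  fix B \<psi> f assume "(B, \<psi>) \<in> alg_of ` em_algs" and f: "f \<in> hom C X B"
  then obtain b where b: "(B, b) \<in> em_algs" and \<psi>: "(B, \<psi>) = alg_of (B, b)"
    by (auto simp: alg_of_def)
  show "interp C \<psi> p f = interp C \<psi> q f"
    using assms(5)[of B b f] b f by (simp add: em_algs_def \<psi>[symmetric])
qed

section \<open>From a model of the theory to an Eilenberg-Moore structure\<close>

context
  fixes A \<phi>
  assumes alg: "(A, \<phi>) \<in> algebras C sig" and sat: "\<forall>e\<in>em_theory. satisfies C P sig (A, \<phi>) e"
begin

lemma A_Obj: "A \<in> Obj C"
  using alg by (simp add: algebras_def)

lemma op_hom:
  assumes "X \<in> P" "Y \<in> P" "w \<in> hom C Y (TO X)" "f \<in> hom C X A"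
  shows "\<phi> (enc (X, w)) f \<in> hom C Y A"
  using interp_hom[OF alg has_arity_Op[OF enc_in_ops[OF assms(1-3)]] assms(4)] by simp

text \<open>In an Eilenberg-Moore algebra this is associativity of composition. It gives the
  compatibility in \<open>w\<close> required by \<open>Kan_id\<close>.\<close>

lemma op_precomp:
  assumes X: "X \<in> P" and Y: "Y \<in> P" and Z: "Z \<in> P" and w: "w \<in> hom C Y (TO X)" and g: "g \<in> hom C Z Y"
    and f: "f \<in> hom C X A"
  shows "\<phi> (enc (X, w \<cdot> g)) f = \<phi> (enc (X, w)) f \<cdot> g"
proof -
  note wg = Comp_in[OF g w]
  have "interp C \<phi> (Op (enc (X, w \<cdot> g))) f = interp C \<phi> (Seq (Var g) (Op (enc (X, w)))) f"
  proof (rule em_equation[OF alg sat _ _ _ f])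
    show "has_arity C P sig (Op (enc (X, w \<cdot> g))) X Z"
      using has_arity_Op enc_in_ops[OF X Z wg] .
    show "has_arity C P sig (Seq (Var g) (Op (enc (X, w)))) X Z"
      using has_arity_Seq has_arity_Op enc_in_ops[OF X Y w] has_arity_Var[OF Y Z g] by metis
    fix B b f assume b: "b \<in> hom C (TO B) B" and f: "f \<in> hom C X B"
    show "interp C (snd (alg_of (B, b))) (Op (enc (X, w \<cdot> g))) f =
        interp C (snd (alg_of (B, b))) (Seq (Var g) (Op (enc (X, w)))) f"
      using f by (simp add: alg_of_enc[OF X Z wg] alg_of_enc[OF X Y w]
          Comp_assoc[OF g Comp_in[OF w T_hom[OF f]] b] Comp_assoc[OF g w T_hom[OF f]])
  qed
  then show ?thesis by simp
qed

text \<open>Valid in Eilenberg-Moore algebras because \<open>T\<close> preserves composition. It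
  gives the compatibility in \<open>f\<close> required by \<open>Kan_T\<close>.\<close>

lemma op_postcomp:
  assumes X: "X \<in> P" and Y: "Y \<in> P" and Z: "Z \<in> P" and w: "w \<in> hom C Z (TO Y)" and g: "g \<in> hom C Y X"
    and f: "f \<in> hom C X A"
  shows "\<phi> (enc (X, TA g \<cdot> w)) f = \<phi> (enc (Y, w)) (f \<cdot> g)"
proof -
  note gw = Comp_in[OF w T_hom[OF g]]
  have "interp C \<phi> (Op (enc (X, TA g \<cdot> w))) f = interp C \<phi> (Seq (Op (enc (Y, w))) (Var g)) f"
  proof (rule em_equation[OF alg sat _ _ _ f])
    show "has_arity C P sig (Op (enc (X, TA g \<cdot> w))) X Z"
      using has_arity_Op enc_in_ops[OF X Z gw] .
    show "has_arity C P sig (Seq (Op (enc (Y, w))) (Var g)) X Z"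
      using has_arity_Seq has_arity_Op enc_in_ops[OF Y Z w] has_arity_Var[OF X Y g] by metis
    fix B b f assume b: "b \<in> hom C (TO B) B" and f: "f \<in> hom C X B"
    show "interp C (snd (alg_of (B, b))) (Op (enc (X, TA g \<cdot> w))) f =
        interp C (snd (alg_of (B, b))) (Seq (Op (enc (Y, w))) (Var g)) f"
      using f Comp_in[OF g f] by (simp add: alg_of_enc[OF X Z gw] alg_of_enc[OF Y Z w]
          T_Comp[OF g f] Comp_assoc[OF w T_hom[OF g] T_hom[OF f]])
  qed
  then show ?thesis by simp
qed

text \<open>In an Eilenberg-Moore algebra, naturality turns \<open>TA f \<cdot> \<eta> X\<close>
  into \<open>\<eta> B \<cdot> f\<close>, and the unit law for \<open>b\<close> removes
  \<open>\<eta> B\<close>.\<close>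

lemma op_eta:
  assumes X: "X \<in> P" and f: "f \<in> hom C X A"
  shows "\<phi> (enc (X, \<eta> X)) f = f"
proof -
  note e = eta_hom[OF P_in[OF X]]
  note i = Ide_in[OF P_in[OF X]]
  have "interp C \<phi> (Op (enc (X, \<eta> X))) f = interp C \<phi> (Var (Ide C X)) f"
  proof (rule em_equation[OF alg sat _ _ _ f])
    show "has_arity C P sig (Op (enc (X, \<eta> X))) X X"
      using has_arity_Op enc_in_ops[OF X X e] .
    show "has_arity C P sig (Var (Ide C X)) X X"
      using has_arity_Var[OF X X i] .
    fix B b f assume B: "B \<in> Obj C" and b: "b \<in> hom C (TO B) B" "b \<cdot> \<eta> B = Ide C B" and f: "f \<in> hom C X B"
    show "interp C (snd (alg_of (B, b))) (Op (enc (X, \<eta> X))) f =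
        interp C (snd (alg_of (B, b))) (Var (Ide C X)) f"
      using f Comp_assoc[OF f eta_hom[OF B] b(1)]
      by (simp add: alg_of_enc[OF X X e] eta_natural[OF f] b(2) Ide_left[OF f] Ide_right[OF f])
  qed
  then show ?thesis using Ide_right[OF f] by simp
qed

text \<open>In an Eilenberg-Moore algebra, naturality moves \<open>\<mu>\<close> to the left of
  \<open>TA f\<close>, the associativity law replaces \<open>\<mu> B\<close> by \<open>TA b\<close>,
  and functoriality collects \<open>TA (b \<cdot> (TA f \<cdot> w))\<close>.\<close>

lemma op_mu:
  assumes X: "X \<in> P" and Y: "Y \<in> P" and Z: "Z \<in> P" and w: "w \<in> hom C Y (TO X)" and v: "v \<in> hom C Z (TO Y)"
    and f: "f \<in> hom C X A"
  shows "\<phi> (enc (X, \<mu> X \<cdot> (TA w \<cdot> v))) f = \<phi> (enc (Y, v)) (\<phi> (enc (X, w)) f)"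
proof -
  note m = mu_hom[OF P_in[OF X]]
  note wv = Comp_in[OF v T_hom[OF w]]
  note mwv = Comp_in[OF wv m]
  have "interp C \<phi> (Op (enc (X, \<mu> X \<cdot> (TA w \<cdot> v)))) f =
      interp C \<phi> (Seq (Op (enc (Y, v))) (Op (enc (X, w)))) f"
  proof (rule em_equation[OF alg sat _ _ _ f])
    show "has_arity C P sig (Op (enc (X, \<mu> X \<cdot> (TA w \<cdot> v)))) X Z"
      using has_arity_Op enc_in_ops[OF X Z mwv] .
    show "has_arity C P sig (Seq (Op (enc (Y, v))) (Op (enc (X, w)))) X Z"
      using has_arity_Seq has_arity_Op enc_in_ops[OF Y Z v] enc_in_ops[OF X Y w] by metis
    fix B b f assume B: "B \<in> Obj C" and b: "b \<in> hom C (TO B) B" "b \<cdot> \<mu> B = b \<cdot> TA b"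
      and f: "f \<in> hom C X B"
    note f' = T_hom[OF f] and f'' = T_hom[OF T_hom[OF f]] and bf = Comp_in[OF w T_hom[OF f]]
    have "b \<cdot> (TA f \<cdot> (\<mu> X \<cdot> (TA w \<cdot> v))) = b \<cdot> ((\<mu> B \<cdot> TA (TA f)) \<cdot> (TA w \<cdot> v))"
      using Comp_assoc[OF wv m f'] mu_natural[OF f] by simp
    also have "\<dots> = (b \<cdot> \<mu> B) \<cdot> (TA (TA f) \<cdot> (TA w \<cdot> v))"
      using Comp_assoc[OF wv f'' mu_hom[OF B]] Comp_assoc[OF Comp_in[OF wv f''] mu_hom[OF B] b(1)] by simp
    also have "\<dots> = b \<cdot> (TA b \<cdot> ((TA (TA f) \<cdot> TA w) \<cdot> v))"
      using Comp_assoc[OF Comp_in[OF wv f''] T_hom[OF b(1)] b(1)] Comp_assoc[OF v T_hom[OF w] f''] b(2)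
      by simp
    also have "\<dots> = b \<cdot> (TA (b \<cdot> (TA f \<cdot> w)) \<cdot> v)"
      using T_Comp[OF w f'] T_Comp[OF bf b(1)] Comp_assoc[OF v T_hom[OF bf] T_hom[OF b(1)]] by simp
    finally show "interp C (snd (alg_of (B, b))) (Op (enc (X, \<mu> X \<cdot> (TA w \<cdot> v)))) f =
        interp C (snd (alg_of (B, b))) (Seq (Op (enc (Y, v))) (Op (enc (X, w)))) f"
      using f Comp_in[OF bf b(1)]
      by (simp add: alg_of_enc[OF X Z mwv] alg_of_enc[OF X Y w] alg_of_enc[OF Y Z v])
  qed
  then show ?thesis by simp
qed

text \<open>The arrow \<open>k\<close> is the future \<open>a \<cdot> TA f\<close>, obtained before
  \<open>a\<close> exists. It comes from \<open>Kan_id\<close> at the object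
  \<open>TO X\<close>.\<close>

lemma ex_extension:
  assumes X: "X \<in> P" and f: "f \<in> hom C X A"
  shows "\<exists>!k. k \<in> hom C (TO X) A \<and> (\<forall>Y\<in>P. \<forall>w\<in>hom C Y (TO X). k \<cdot> w = \<phi> (enc (X, w)) f)"
  using left_Kan_ex1[OF Kan_id T_Obj[OF P_in[OF X]] A_Obj, of "\<lambda>w. \<phi> (enc (X, w)) f"]
  by (simp add: op_hom[OF X _ _ f] op_precomp[OF X _ _ _ _ f])

lemma ex_structure: "\<exists>a. (A, a) \<in> em_algs \<and> alg_of (A, a) = (A, \<phi>)"
proof -
  \<comment> \<open>\<open>left_Kan_ex1\<close> takes a family that depends on the arrow alone, so
    \<open>X\<close> is recovered as \<open>Dom C f\<close>.\<close>
  define k where "k f = (THE k. k \<in> hom C (TO (Dom C f)) A \<and>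
    (\<forall>Y\<in>P. \<forall>w\<in>hom C Y (TO (Dom C f)). k \<cdot> w = \<phi> (enc (Dom C f, w)) f))" for f
  have k: "k f \<in> hom C (TO X) A" and kw: "\<And>Y w. Y \<in> P \<Longrightarrow> w \<in> hom C Y (TO X) \<Longrightarrow> k f \<cdot> w = \<phi> (enc (X, w)) f"
    if "X \<in> P" "f \<in> hom C X A" for X f
    using theI'[OF ex_extension[OF that]] homD(2)[OF that(2)] by (auto simp: k_def)
  have "\<exists>!a. a \<in> hom C (TO A) A \<and> (\<forall>X\<in>P. \<forall>f\<in>hom C X A. a \<cdot> TA f = k f)"
  proof (rule left_Kan_ex1[OF Kan_T A_Obj A_Obj])
    show "k f \<in> hom C (TO X) A" if "X \<in> P" "f \<in> hom C X A" for X f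
      using k that .
    fix X Y f g assume X: "X \<in> P" and Y: "Y \<in> P" and f: "f \<in> hom C X A" and g: "g \<in> hom C Y X"
    show "k (f \<cdot> g) = k f \<cdot> TA g"
    proof (rule eqI_on_P[OF k[OF Y Comp_in[OF g f]] Comp_in[OF T_hom[OF g] k[OF X f]]])
      fix Z w assume Z: "Z \<in> P" and w: "w \<in> hom C Z (TO Y)"
      show "k (f \<cdot> g) \<cdot> w = k f \<cdot> TA g \<cdot> w"
        using kw[OF Y Comp_in[OF g f] Z w] kw[OF X f Z Comp_in[OF w T_hom[OF g]]]
          op_postcomp[OF X Y Z w g f] Comp_assoc[OF w T_hom[OF g] k[OF X f]] by simp
    qed
  qed
  then obtain a where a: "a \<in> hom C (TO A) A" and ak: "\<And>X f. X \<in> P \<Longrightarrow> f \<in> hom C X A \<Longrightarrow> a \<cdot> TA f = k f"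
    by blast
  \<comment> \<open>The glued arrow \<open>a\<close> reproduces the given operations; from here on
    the laws for \<open>a\<close> reduce to laws for \<open>\<phi>\<close>.\<close>
  have act: "a \<cdot> (TA f \<cdot> w) = \<phi> (enc (X, w)) f"
    if "X \<in> P" "Y \<in> P" "f \<in> hom C X A" "w \<in> hom C Y (TO X)" for X Y f w
    using Comp_assoc[OF that(4) T_hom[OF that(3)] a] ak[OF that(1,3)] kw[OF that(1,3,2,4)] by simp
  have unit: "a \<cdot> \<eta> A = Ide C A"
  proof (rule eqI_on_P[OF Comp_in[OF eta_hom[OF A_Obj] a] Ide_in[OF A_Obj]])
    fix X f assume X: "X \<in> P" and f: "f \<in> hom C X A"
    \<comment> \<open>Naturality turns \<open>\<eta> A \<cdot> f\<close> into
      \<open>TA f \<cdot> \<eta> X\<close>, to which \<open>act\<close> applies.\<close>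
    show "a \<cdot> \<eta> A \<cdot> f = Ide C A \<cdot> f"
      using Comp_assoc[OF f eta_hom[OF A_Obj] a] eta_natural[OF f] act[OF X X f eta_hom[OF P_in[OF X]]]
        op_eta[OF X f] Ide_left[OF f] by simp
  qed
  have assoc: "a \<cdot> \<mu> A = a \<cdot> TA a"
  proof (rule eqI_on_TTP[OF Comp_in[OF mu_hom[OF A_Obj] a] Comp_in[OF T_hom[OF a] a] A_Obj])
    fix X Y Z f w v assume X: "X \<in> P" and Y: "Y \<in> P" and Z: "Z \<in> P" and f: "f \<in> hom C X A"
      and w: "w \<in> hom C Y (TO X)" and v: "v \<in> hom C Z (TO Y)"
    note f' = T_hom[OF f] and f'' = T_hom[OF T_hom[OF f]] and wv = Comp_in[OF v T_hom[OF w]]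
      and m = mu_hom[OF P_in[OF X]] and fw = Comp_in[OF w T_hom[OF f]]
    have "a \<cdot> \<mu> A \<cdot> (TA (TA f) \<cdot> (TA w \<cdot> v)) = a \<cdot> ((\<mu> A \<cdot> TA (TA f)) \<cdot> (TA w \<cdot> v))"
      using Comp_assoc[OF wv f'' mu_hom[OF A_Obj]] Comp_assoc[OF Comp_in[OF wv f''] mu_hom[OF A_Obj] a]
      by simp
    also have "\<dots> = a \<cdot> (TA f \<cdot> (\<mu> X \<cdot> (TA w \<cdot> v)))"
      using Comp_assoc[OF wv m f'] mu_natural[OF f] by simp
    also have "\<dots> = \<phi> (enc (Y, v)) (\<phi> (enc (X, w)) f)"
      using act[OF X Z f Comp_in[OF wv m]] op_mu[OF X Y Z w v f] by simp
    \<comment> \<open>Here \<open>act\<close> is read backwards, first with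
      \<open>\<phi> (enc (X, w)) f\<close> in the role of \<open>f\<close>.\<close>
    also have "\<dots> = a \<cdot> (TA (a \<cdot> (TA f \<cdot> w)) \<cdot> v)"
      using act[OF Y Z op_hom[OF X Y w f] v] act[OF X Y f w] by simp
    also have "\<dots> = a \<cdot> (TA a \<cdot> ((TA (TA f) \<cdot> TA w) \<cdot> v))"
      using T_Comp[OF w f'] T_Comp[OF fw a] Comp_assoc[OF v T_hom[OF fw] T_hom[OF a]] by simp
    also have "\<dots> = a \<cdot> TA a \<cdot> (TA (TA f) \<cdot> (TA w \<cdot> v))"
      using Comp_assoc[OF Comp_in[OF wv f''] T_hom[OF a] a] Comp_assoc[OF v T_hom[OF w] f''] by simp
    finally show "a \<cdot> \<mu> A \<cdot> (TA (TA f) \<cdot> (TA w \<cdot> v)) = a \<cdot> TA a \<cdot> (TA (TA f) \<cdot> (TA w \<cdot> v))" .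
  qed
  \<comment> \<open>By \<open>act\<close> the operations agree on elements of the hom-sets;
    elsewhere, and outside \<open>Ops sig\<close>, both sides have the default value of extensional
    functions.\<close>
  have "snd (alg_of (A, a)) = \<phi>"
  proof (rule extensionalityI[of _ "Ops sig"])
    show "snd (alg_of (A, a)) \<in> extensional (Ops sig)" by (simp add: alg_of_def)
    show "\<phi> \<in> extensional (Ops sig)" using alg by (auto simp: algebras_def PiE_def)
    fix \<omega> assume \<omega>: "\<omega> \<in> Ops sig"
    then show "snd (alg_of (A, a)) \<omega> = \<phi> \<omega>"
    proof (cases rule: Ops_cases)
      case (1 X Y w)
      have "\<phi> \<omega> \<in> hom C X A \<rightarrow>\<^sub>E hom C Y A"
        using alg \<omega> arity_enc[OF 1(1-3)] 1(4) by (force simp: algebras_def)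
      then show ?thesis
        using act[OF 1(1,2) _ 1(3)] alg_of_enc[OF 1(1-3)] 1(4)
        by (auto simp: fun_eq_iff restrict_def PiE_def extensional_def)
    qed
  qed
  then have "alg_of (A, a) = (A, \<phi>)" by (simp add: alg_of_def)
  then show ?thesis using A_Obj a unit assoc by (auto simp: em_algs_def)
qed

end

section \<open>The comparison on objects and on homomorphisms\<close>

lemma em_algsD:
  assumes "(A, a) \<in> em_algs"
  shows "A \<in> Obj C" "a \<in> hom C (TO A) A"
  using assms by (simp_all add: em_algs_def)

text \<open>Injectivity holds because the operations record all values
  \<open>a \<cdot> (TA f \<cdot> w)\<close>, which determine \<open>a\<close> by
  \<open>eqI_on_TP\<close>. Surjectivity onto the models is \<open>ex_structure\<close>.\<close>

lemma bij_alg_of: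
  "bij_betw alg_of em_algs {\<A> \<in> algebras C sig. \<forall>e\<in>em_theory. satisfies C P sig \<A> e}"
proof (rule bij_betw_imageI)
  show "inj_on alg_of em_algs"
  proof (rule inj_onI, clarify)
    fix A a B b assume "(A, a) \<in> em_algs" and "(B, b) \<in> em_algs" and eq: "alg_of (A, a) = alg_of (B, b)"
    then have AB: "A = B" and A: "A \<in> Obj C" and a: "a \<in> hom C (TO A) A" and b: "b \<in> hom C (TO A) A"
      by (auto simp: alg_of_def dest: em_algsD)
    have "a = b"
    proof (rule eqI_on_TP[OF a b A])
      fix X Y f w assume X: "X \<in> P" and Y: "Y \<in> P" and f: "f \<in> hom C X A" and w: "w \<in> hom C Y (TO X)"
      have "snd (alg_of (A, a)) (enc (X, w)) f = snd (alg_of (A, b)) (enc (X, w)) f"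
        using eq AB by simp
      then show "a \<cdot> (TA f \<cdot> w) = b \<cdot> (TA f \<cdot> w)"
        using alg_of_enc[OF X Y w] f by simp
    qed
    then show "A = B \<and> a = b" using AB by simp
  qed
  show "alg_of ` em_algs = {\<A> \<in> algebras C sig. \<forall>e\<in>em_theory. satisfies C P sig \<A> e}"
  proof (intro equalityI subsetI)
    show "\<A> \<in> {\<A> \<in> algebras C sig. \<forall>e\<in>em_theory. satisfies C P sig \<A> e}" if "\<A> \<in> alg_of ` em_algs" for \<A>
      using that alg_of_em_algs satisfies_theory_of[OF is_type_sig alg_of_em_algs that]
      by (auto simp: em_theory_def)
    show "\<A> \<in> alg_of ` em_algs" if "\<A> \<in> {\<A> \<in> algebras C sig. \<forall>e\<in>em_theory. satisfies C P sig \<A> e}" for \<A>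
    proof (cases \<A>)
      case (Pair A \<phi>)
      then have "(A, \<phi>) \<in> algebras C sig" "\<forall>e\<in>em_theory. satisfies C P sig (A, \<phi>) e"
        using that by simp_all
      from ex_structure[OF this] obtain a where "(A, a) \<in> em_algs" "\<A> = alg_of (A, a)"
        using Pair by auto
      then show ?thesis by (intro image_eqI)
    qed
  qed
qed

text \<open>Preserving the operation of \<open>w\<close> at \<open>f\<close> means that
  \<open>h \<cdot> a\<close> and \<open>b \<cdot> TA h\<close> agree after
  \<open>TA f \<cdot> w\<close>; by \<open>eqI_on_TP\<close> these tests together decide their
  equality.\<close>

lemma em_hom_iff:
  assumes "(A, a) \<in> em_algs" "(B, b) \<in> em_algs" and h: "h \<in> hom C A B"
  shows "h \<cdot> a = b \<cdot> TA h \<longleftrightarrow> (\<forall>\<omega>\<in>Ops sig. \<forall>f\<in>hom C (fst (arity sig \<omega>)) A.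
    h \<cdot> snd (alg_of (A, a)) \<omega> f = snd (alg_of (B, b)) \<omega> (h \<cdot> f))" (is "_ = ?R")
proof -
  note A = em_algsD[OF assms(1)] and B = em_algsD[OF assms(2)]
  note ha = Comp_in[OF A(2) h] and bh = Comp_in[OF T_hom[OF h] B(2)]
  have hA: "h \<cdot> snd (alg_of (A, a)) (enc (X, w)) f = h \<cdot> a \<cdot> (TA f \<cdot> w)"
    and hB: "snd (alg_of (B, b)) (enc (X, w)) (h \<cdot> f) = b \<cdot> TA h \<cdot> (TA f \<cdot> w)"
    if X: "X \<in> P" and Y: "Y \<in> P" and w: "w \<in> hom C Y (TO X)" and f: "f \<in> hom C X A" for X Y w f
  proof -
    note fw = Comp_in[OF w T_hom[OF f]]
    show "h \<cdot> snd (alg_of (A, a)) (enc (X, w)) f = h \<cdot> a \<cdot> (TA f \<cdot> w)"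
      using Comp_assoc[OF fw A(2) h] alg_of_enc[OF X Y w] f by simp
    show "snd (alg_of (B, b)) (enc (X, w)) (h \<cdot> f) = b \<cdot> TA h \<cdot> (TA f \<cdot> w)"
      using Comp_assoc[OF fw T_hom[OF h] B(2)] Comp_assoc[OF w T_hom[OF f] T_hom[OF h]]
        T_Comp[OF f h] alg_of_enc[OF X Y w] Comp_in[OF f h] by simp
  qed
  show ?thesis
  proof
    assume eq: "h \<cdot> a = b \<cdot> TA h"
    show ?R
    proof (intro ballI)
      fix \<omega> f assume "\<omega> \<in> Ops sig" and f: "f \<in> hom C (fst (arity sig \<omega>)) A"
      then show "h \<cdot> snd (alg_of (A, a)) \<omega> f = snd (alg_of (B, b)) \<omega> (h \<cdot> f)"
      proof (cases rule: Ops_cases)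
        case (1 X Y w)
        then have "f \<in> hom C X A" using f arity_enc[OF 1(1-3)] by simp
        then show ?thesis using hA[OF 1(1-3)] hB[OF 1(1-3)] 1(4) eq by simp
      qed
    qed
  next
    assume R: ?R
    show "h \<cdot> a = b \<cdot> TA h"
    proof (rule eqI_on_TP[OF ha bh A(1)])
      fix X Y f w assume X: "X \<in> P" and Y: "Y \<in> P" and f: "f \<in> hom C X A" and w: "w \<in> hom C Y (TO X)"
      have "h \<cdot> snd (alg_of (A, a)) (enc (X, w)) f = snd (alg_of (B, b)) (enc (X, w)) (h \<cdot> f)"
        using R enc_in_Ops[OF X Y w] arity_enc[OF X Y w] f by simp
      then show "h \<cdot> a \<cdot> (TA f \<cdot> w) = b \<cdot> TA h \<cdot> (TA f \<cdot> w)"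
        using hA[OF X Y w f] hB[OF X Y w f] by simp
    qed
  qed
qed

lemma concretely_equivalent_EM_Alg:
  "concretely_equivalent (EM C T) forget (Alg C P sig em_theory) forget"
  unfolding EM_def Alg_def em_algs_def[symmetric]
proof (rule concretely_equivalent_concrete_cat[OF bij_alg_of])
  show "fst \<A> \<in> Obj C" if "\<A> \<in> em_algs" for \<A>
    using that by (auto simp: em_algs_def)
  show "fst (alg_of \<A>) = fst \<A>" if "\<A> \<in> em_algs" for \<A>
    by (cases \<A>) simp
  show "(\<lambda>(A, a) (B, b) h. h \<cdot> a = b \<cdot> TA h) \<A> \<A> (Ide C (fst \<A>))" if "\<A> \<in> em_algs" for \<A>
  proof (cases \<A>)
    case (Pair A a)
    note A = em_algsD[OF that[unfolded Pair]]
    show ?thesis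
      using Ide_left[OF A(2)] Ide_right[OF A(2)] functor_Ide[OF T_functor A(1)] by (simp add: Pair)
  qed
  fix \<A> \<B> h assume AB: "\<A> \<in> em_algs" "\<B> \<in> em_algs" "h \<in> hom C (fst \<A>) (fst \<B>)"
  show "(\<lambda>(A, a) (B, b) h. h \<cdot> a = b \<cdot> TA h) \<A> \<B> h \<longleftrightarrow>
      (\<lambda>(A, \<phi>) (B, \<psi>) h. \<forall>\<omega>\<in>Ops sig. \<forall>f\<in>hom C (fst (arity sig \<omega>)) A.
        h \<cdot> \<phi> \<omega> f = \<psi> \<omega> (h \<cdot> f)) (alg_of \<A>) (alg_of \<B>) h"
  proof (cases \<A>; cases \<B>)
    fix A a B b assume [simp]: "\<A> = (A, a)" "\<B> = (B, b)"
    show ?thesis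
      using em_hom_iff[of A a B b h] AB by (simp add: split_beta)
  qed
qed

end

section \<open>Encoding the symbols in the universe and instantiating the construction\<close>

theorem theorem3p12:
  fixes U :: "'u rel" and lam :: "'l rel"
    and K :: "('o, 'm) cat" and Kl :: "'o set" and T :: "('o, 'm) monad"
  assumes "regular_cardinal U"
    and "regular_cardinal lam" and "lam <o U"
    and "locally_presentable U lam K"
    and "representative_presentables U lam K Kl"
    and "ary_monad U lam K T"
  shows "\<exists>(t :: ('o, 'u) optype) E.
    is_type U K Kl t \<and> is_equational_theory K Kl t E \<and>
    concretely_equivalent (EM K T) forget (Alg K Kl t E) forget"
proof -
  interpret category K using assms(4) by (simp add: locally_presentable_def)
  have ls: "locally_small U K" using assms(4) by (simp add: locally_presentable_def)
  have Kl: "small U Kl" "Kl \<subseteq> Obj K"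
    using assms(5) by (auto simp: representative_presentables_def presentable_def)
  have T: "is_functor K K (endo T)" "preserves_filtered_colimits U lam K K (endo T)" "is_monad K T"
    using assms(6) by (simp_all add: ary_monad_def is_monad_def)
  note Kan = left_Kan_if_preserves_filtered_colimits[OF assms(4,5) _ _ category_axioms]
  let ?S = "{(X, w). X \<in> Kl \<and> w \<in> Arr K \<and> Dom K w \<in> Kl \<and> Cod K w = onObj (endo T) X}"
  have U: "Cinfinite U" "regularCard U" using assms(1) by (simp_all add: regular_cardinal_def)
  \<comment> \<open>All symbols together form a small union of small hom-sets, so regularity of
    \<open>U\<close> bounds their number.\<close>
  have "small U (\<Union>X\<in>Kl. \<Union>Y\<in>Kl. Pair X ` hom K Y (onObj (endo T) X))"
    unfolding small_def
  proof (intro regularCard_UNION_bound[OF U])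
    show "|Kl| <o U" "|Kl| <o U" using Kl(1) by (simp_all add: small_def)
    fix X Y assume "X \<in> Kl" "Y \<in> Kl"
    then have "|hom K Y (onObj (endo T) X)| <o U"
      using ls Kl(2) functor_Obj[OF T(1)] unfolding locally_small_def small_def by blast
    then show "|Pair X ` hom K Y (onObj (endo T) X)| <o U"
      using card_of_image ordLeq_ordLess_trans by blast
  qed
  moreover have "?S \<subseteq> (\<Union>X\<in>Kl. \<Union>Y\<in>Kl. Pair X ` hom K Y (onObj (endo T) X))"
    by (auto simp: hom_def)
  ultimately have "|?S| <o U" using small_subset unfolding small_def by blast
  moreover have "U =o |Field U|" using U(1) card_of_Field_ordIso ordIso_symmetric by blast
  \<comment> \<open>Fewer than \<open>U\<close> symbols inject into the field of \<open>U\<close>,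
    and so into its carrier type, which supplies \<open>enc\<close>.\<close>
  ultimately have "|?S| \<le>o |Field U|"
    using ordLess_imp_ordLeq ordLeq_ordIso_trans by blast
  then obtain enc :: "'o \<times> 'm \<Rightarrow> 'u" where enc: "inj_on enc ?S"
    by (auto simp: card_of_ordLeq[symmetric])
  interpret monad_presentation K U T Kl enc
  proof
    show "left_Kan K Kl ftor_id K"
      by (rule Kan[OF is_functor_id preserves_filtered_colimits_id])
    show "left_Kan K Kl (endo T) K"
      by (rule Kan[OF T(1,2)])
    show "left_Kan K Kl (endo T \<circ>\<^sub>F endo T) K"
      by (rule Kan[OF is_functor_comp[OF T(1,1)] preserves_filtered_colimits_comp[OF T(2,2,1)]])
  qed (fact ls T(3) Kl(2) enc)+
  show ?thesis
    using is_type_sig is_equational_theory_theory_of[OF is_type_sig] concretely_equivalent_EM_Alg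
    unfolding em_theory_def by blast
qed

end
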